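(* Let $f:\mathbb{R}^n\to\mathbb{R}$ be $L$-smooth and $\mu$-strongly convex ($\mu>0$), let $g$ be convex, proper and lower semicontinuous on $\mathbb{R}^n$, and let $x^\star$ be the unique minimizer of $f+g$ on $\mathbb{R}^n$. Let $\mathcal{C}=\{\mathcal{C}_i\}$ be a covering family of subspaces of $\mathbb{R}^n$ and let $\mathfrak{S}^1,\mathfrak{S}^2,\ldots$ be an i.i.d. sequence of admissible selections from $\mathcal{C}$, with average projection $\mathsf{P}=\mathbb{E}[P_{\mathfrak{S}}]$ and $\mathsf{Q}=\mathsf{P}^{-1/2}$. Then, for any $\gamma\in(0,2/(\mu+L)]$, the sequence $(x^k)$ of iterates of the RPSD algorithm converges almost surely to $x^\star$, with rate $$\mathbb{E}\left[\|x^{k+1}-x^\star\|_2^2\right]\le\left(1-\lambda_{\min}(\mathsf{P})\frac{2\gamma\mu L}{\mu+L}\right)^k C,$$ where $C=\lambda_{\max}(\mathsf{P})\,\|z^0-\mathsf{Q}(x^\star-\gamma\nabla f(x^\star))\|_2^2$.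
   Context: A family $\mathcal{C}=\{\mathcal{C}_i\}_i$ of linear subspaces of $\mathbb{R}^n$ is covering if $\sum_i\mathcal{C}_i=\mathbb{R}^n$. A selection $\mathfrak{S}$ from $\mathcal{C}$ is a random subspace: a random subset $\omega=\{\mathcal{C}_{i_1},\ldots,\mathcal{C}_{i_s}\}$ of $\mathcal{C}$ is drawn and $\mathfrak{S}(\omega)=\sum_{j=1}^s\mathcal{C}_{i_j}$. It is admissible if $\mathbb{P}[x\in\mathfrak{S}^\perp]<1$ for all $x\in\mathbb{R}^n\setminus\{0\}$. $P_F$ denotes the orthogonal projection matrix onto the subspace $F$. For an admissible selection, $\mathsf{P}=\mathbb{E}[P_{\mathfrak{S}}]$ is positive definite; $\lambda_{\min}(\mathsf{P})$, $\lambda_{\max}(\mathsf{P})$ are its extreme eigenvalues. The proximity operator is $\mathbf{prox}_{\gamma g}(x)=\mathrm{argmin}_{y\in\mathbb{R}^n}\{g(y)+\frac{1}{2\gamma}\|y-x\|_2^2\}$. "$L$-smooth" means differentiable with $L$-Lipschitz gradient. RPSD algorithm (Randomized Proximal Subspace Descent) with stepsize $\gamma$: given a (deterministic) $z^0\in\mathbb{R}^n$, set $x^1=\mathbf{prox}_{\gamma g}(\mathsf{Q}^{-1}z^0)$ and for $k=1,2,\ldots$ $$y^k=\mathsf{Q}(x^k-\gamma\nabla f(x^k)),\qquad z^k=P_{\mathfrak{S}^k}(y^k)+(I-P_{\mathfrak{S}^k})(z^{k-1}),\qquad x^{k+1}=\mathbf{prox}_{\gamma g}(\mathsf{Q}^{-1}(z^k)).$$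 *)

theory Defs
  imports "HOL-Probability.Probability"
begin

text \<open>The sum of a possibly infinite family of subspaces consists of all finite sums.\<close>

definition subspace_sum :: "('i \<Rightarrow> 'a::real_vector set) \<Rightarrow> 'i set \<Rightarrow> 'a set" where
  "subspace_sum C J =
     {\<Sum>i\<in>K. v i | K v. finite K \<and> K \<subseteq> J \<and> (\<forall>i\<in>K. v i \<in> C i)}"

definition covering_family :: "('i \<Rightarrow> (real^'n) set) \<Rightarrow> bool" where
  "covering_family C \<longleftrightarrow> (\<forall>i. subspace (C i)) \<and> subspace_sum C UNIV = UNIV"

definition proj_matrix :: "(real^'n) set \<Rightarrow> real^'n^'n" where
  "proj_matrix F = (THE P. \<forall>x. P *v x \<in> F \<and> x - P *v x \<in> F\<^sup>\<bottom>)"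

definition positive_definite :: "real^'n^'n \<Rightarrow> bool" where
  "positive_definite A \<longleftrightarrow> transpose A = A \<and> (\<forall>x. x \<noteq> 0 \<longrightarrow> x \<bullet> (A *v x) > 0)"

text \<open>The principal square root; meaningful for positive definite \<open>A\<close>.\<close>

definition matrix_sqrt :: "real^'n^'n \<Rightarrow> real^'n^'n" where
  "matrix_sqrt A = (THE B. positive_definite B \<and> B ** B = A)"

definition eigenvalues :: "real^'n^'n \<Rightarrow> real set" where
  "eigenvalues A = {c. \<exists>v. v \<noteq> 0 \<and> A *v v = c *\<^sub>R v}"

definition lambda_min :: "real^'n^'n \<Rightarrow> real" where
  "lambda_min A = Min (eigenvalues A)"

definition lambda_max :: "real^'n^'n \<Rightarrow> real" where
  "lambda_max A = Max (eigenvalues A)"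

text \<open>The set of linear subspaces carries the coarsest \<open>\<sigma>\<close>-algebra for which \<open>F \<mapsto> P\<^sub>F\<close>
  is Borel measurable.\<close>

definition subspace_algebra :: "(real^'n) set measure" where
  "subspace_algebra = vimage_algebra {F. subspace F} proj_matrix borel"

text \<open>A selection is the sum over a random finite subfamily \<open>J\<close>.  Measurability is only required
  of the resulting subspace, so that no \<open>\<sigma>\<close>-algebra on the subsets of the (possibly uncountable)
  family has to be fixed.\<close>

definition selection ::
  "'w measure \<Rightarrow> ('i \<Rightarrow> (real^'n) set) \<Rightarrow> ('w \<Rightarrow> (real^'n) set) \<Rightarrow> bool" where
  "selection M C S \<longleftrightarrow>
     S \<in> measurable M subspace_algebra \<and>
     (\<exists>J. \<forall>\<omega>\<in>space M. finite (J \<omega>) \<and> S \<omega> = subspace_sum C (J \<omega>))"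

definition admissible :: "'w measure \<Rightarrow> ('w \<Rightarrow> (real^'n) set) \<Rightarrow> bool" where
  "admissible M S \<longleftrightarrow> (\<forall>x. x \<noteq> 0 \<longrightarrow> measure M {\<omega>\<in>space M. x \<in> (S \<omega>)\<^sup>\<bottom>} < 1)"

text \<open>Indexed by the positive integers; the value at index 0 is irrelevant.\<close>

definition iid_subspaces :: "'w measure \<Rightarrow> (nat \<Rightarrow> 'w \<Rightarrow> (real^'n) set) \<Rightarrow> bool" where
  "iid_subspaces M S \<longleftrightarrow>
     prob_space.indep_vars M (\<lambda>_. subspace_algebra) S {1..} \<and>
     (\<forall>k\<ge>1. distr M subspace_algebra (S k) = distr M subspace_algebra (S 1))"

definition avg_proj :: "'w measure \<Rightarrow> ('w \<Rightarrow> (real^'n) set) \<Rightarrow> real^'n^'n" where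
  "avg_proj M S = (\<integral>\<omega>. proj_matrix (S \<omega>) \<partial>M)"

definition grad :: "('a::real_inner \<Rightarrow> real) \<Rightarrow> 'a \<Rightarrow> 'a" where
  "grad f x = (THE D. GDERIV f x :> D)"

definition smooth_with :: "real \<Rightarrow> ('a::real_inner \<Rightarrow> real) \<Rightarrow> bool" where
  "smooth_with L f \<longleftrightarrow> (\<forall>x. f differentiable (at x)) \<and> L-lipschitz_on UNIV (grad f)"

definition strongly_convex :: "real \<Rightarrow> ('a::real_inner \<Rightarrow> real) \<Rightarrow> bool" where
  "strongly_convex \<mu> f \<longleftrightarrow>
     (\<forall>x y u v. 0 \<le> u \<longrightarrow> 0 \<le> v \<longrightarrow> u + v = 1 \<longrightarrow>
        f (u *\<^sub>R x + v *\<^sub>R y) \<le> u * f x + v * f y - \<mu> / 2 * u * v * (norm (x - y))\<^sup>2)"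

definition proper_fun :: "('a \<Rightarrow> ereal) \<Rightarrow> bool" where
  "proper_fun g \<longleftrightarrow> (\<forall>x. g x \<noteq> -\<infinity>) \<and> (\<exists>x. g x \<noteq> \<infinity>)"

definition convex_fun :: "('a::real_vector \<Rightarrow> ereal) \<Rightarrow> bool" where
  "convex_fun g \<longleftrightarrow>
     (\<forall>x y u v. 0 \<le> u \<longrightarrow> 0 \<le> v \<longrightarrow> u + v = 1 \<longrightarrow>
        g (u *\<^sub>R x + v *\<^sub>R y) \<le> ereal u * g x + ereal v * g y)"

definition lsc_fun :: "('a::topological_space \<Rightarrow> ereal) \<Rightarrow> bool" where
  "lsc_fun g \<longleftrightarrow> (\<forall>x. g x \<le> Liminf (at x) g)"

definition prox :: "real \<Rightarrow> ('a::real_inner \<Rightarrow> ereal) \<Rightarrow> 'a \<Rightarrow> 'a" where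
  "prox \<gamma> g x = (ARG_MIN (\<lambda>y. g y + ereal (1 / (2 * \<gamma>) * (norm (y - x))\<^sup>2)) y. True)"

text \<open>One run of the algorithm for a given sequence \<open>S 1, S 2, \<dots>\<close> of subspaces.  The entries
  \<open>x 0\<close>, \<open>y 0\<close> and \<open>S 0\<close> are unused.\<close>

definition rpsd_run ::
  "real \<Rightarrow> (real^'n \<Rightarrow> real) \<Rightarrow> (real^'n \<Rightarrow> ereal) \<Rightarrow> real^'n^'n \<Rightarrow> (nat \<Rightarrow> (real^'n) set) \<Rightarrow> real^'n
    \<Rightarrow> (nat \<Rightarrow> real^'n) \<Rightarrow> (nat \<Rightarrow> real^'n) \<Rightarrow> (nat \<Rightarrow> real^'n) \<Rightarrow> bool" where
  "rpsd_run \<gamma> f g Q S z0 x y z \<longleftrightarrow>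
     z 0 = z0 \<and>
     x 1 = prox \<gamma> g (matrix_inv Q *v z0) \<and>
     (\<forall>k\<ge>1.
        y k = Q *v (x k - \<gamma> *\<^sub>R grad f (x k)) \<and>
        z k = proj_matrix (S k) *v y k + (mat 1 - proj_matrix (S k)) *v z (k - 1) \<and>
        x (k + 1) = prox \<gamma> g (matrix_inv Q *v z k))"

lemma subspace_sum_eq_span:
  assumes "\<And>i. i \<in> J \<Longrightarrow> subspace (C i)"
  shows "subspace_sum C J = span (\<Union>i\<in>J. C i)"
proof
  show "subspace_sum C J \<subseteq> span (\<Union>i\<in>J. C i)"
    unfolding subspace_sum_def by (auto intro!: span_sum) (meson UN_I span_base subsetD)
next
  have "subspace (subspace_sum C J)"
  proof (rule subspaceI)
    show "0 \<in> subspace_sum C J"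
      unfolding subspace_sum_def by (auto intro!: exI[of _ "{}"])
  next
    fix a b assume "a \<in> subspace_sum C J" "b \<in> subspace_sum C J"
    then obtain K v K' v' where
      K: "finite K" "K \<subseteq> J" "\<forall>i\<in>K. v i \<in> C i" "a = (\<Sum>i\<in>K. v i)" and
      K': "finite K'" "K' \<subseteq> J" "\<forall>i\<in>K'. v' i \<in> C i" "b = (\<Sum>i\<in>K'. v' i)"
      unfolding subspace_sum_def by blast
    define w where "w i = (if i \<in> K then v i else 0) + (if i \<in> K' then v' i else 0)" for i
    have 1: "(\<Sum>i\<in>K \<union> K'. if i \<in> K then v i else 0) = a"
      unfolding K(4) using K K' by (intro sum.mono_neutral_cong_right) auto
    have 2: "(\<Sum>i\<in>K \<union> K'. if i \<in> K' then v' i else 0) = b"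
      unfolding K'(4) using K K' by (intro sum.mono_neutral_cong_right) auto
    have "w i \<in> C i" if "i \<in> K \<union> K'" for i
      unfolding w_def using that K K' assms[of i]
      by (intro subspace_add) (auto simp: subspace_0)
    moreover have "a + b = (\<Sum>i\<in>K \<union> K'. w i)"
      unfolding w_def sum.distrib 1 2 ..
    ultimately show "a + b \<in> subspace_sum C J"
      unfolding subspace_sum_def using K K'
      by (auto intro!: exI[of _ "K \<union> K'"] exI[of _ w])
  next
    fix c :: real and a assume "a \<in> subspace_sum C J"
    then obtain K v where
      K: "finite K" "K \<subseteq> J" "\<forall>i\<in>K. v i \<in> C i" "a = (\<Sum>i\<in>K. v i)"
      unfolding subspace_sum_def by blast
    then show "c *\<^sub>R a \<in> subspace_sum C J"
      unfolding subspace_sum_def using assms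
      by (auto intro!: exI[of _ K] exI[of _ "\<lambda>i. c *\<^sub>R v i"] subspace_scale simp: scaleR_sum_right)
  qed
  moreover have "(\<Union>i\<in>J. C i) \<subseteq> subspace_sum C J"
  proof
    fix a assume "a \<in> (\<Union>i\<in>J. C i)"
    then obtain i where "i \<in> J" "a \<in> C i" by blast
    then show "a \<in> subspace_sum C J"
      unfolding subspace_sum_def by (auto intro!: exI[of _ "{i}"] exI[of _ "\<lambda>_. a"])
  qed
  ultimately show "span (\<Union>i\<in>J. C i) \<subseteq> subspace_sum C J"
    by (rule span_minimal[rotated])
qed

lemma ex1_proj_matrix:
  fixes F :: "(real^'n) set"
  assumes F: "subspace F"
  shows "\<exists>!P. \<forall>x. P *v x \<in> F \<and> x - P *v x \<in> F\<^sup>\<bottom>"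
proof -
  have ex: "\<exists>p. p \<in> F \<and> x - p \<in> F\<^sup>\<bottom>" for x
  proof -
    obtain p q where pq: "p \<in> span F" "\<And>w. w \<in> span F \<Longrightarrow> orthogonal q w" "x = p + q"
      using orthogonal_subspace_decomp_exists[of F x] by blast
    have "x - p \<in> F\<^sup>\<bottom>"
      using pq by (auto simp: orthogonal_comp_def orthogonal_commute span_base)
    then show ?thesis using pq(1) F by (metis span_eq_iff)
  qed
  have uniq: "p = p'" if "p \<in> F" "x - p \<in> F\<^sup>\<bottom>" "p' \<in> F" "x - p' \<in> F\<^sup>\<bottom>" for x p p'
  proof -
    have "p - p' \<in> F" using that F by (auto intro: subspace_diff)
    moreover have "p - p' \<in> F\<^sup>\<bottom>"
      using subspace_diff[OF subspace_orthogonal_comp that(4) that(2)] by simp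
    ultimately have "orthogonal (p - p') (p - p')" by (auto simp: orthogonal_comp_def)
    then show ?thesis by (simp add: orthogonal_self)
  qed
  from ex obtain h where h: "\<And>x. h x \<in> F" "\<And>x. x - h x \<in> F\<^sup>\<bottom>" by metis
  have "linear h"
  proof (rule linearI)
    fix a b
    have "(a - h a) + (b - h b) \<in> F\<^sup>\<bottom>"
      using h subspace_add[OF subspace_orthogonal_comp] by blast
    then show "h (a + b) = h a + h b"
      using h F by (intro uniq[of _ "a + b"]) (auto intro: subspace_add simp: algebra_simps)
  next
    fix c :: real and a
    have "c *\<^sub>R (a - h a) \<in> F\<^sup>\<bottom>"
      using h subspace_scale[OF subspace_orthogonal_comp] by blast
    then show "h (c *\<^sub>R a) = c *\<^sub>R h a"
      using h F by (intro uniq[of _ "c *\<^sub>R a"]) (auto intro: subspace_scale simp: algebra_simps)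
  qed
  then have "matrix h *v x = h x" for x by simp
  then have "\<forall>x. matrix h *v x \<in> F \<and> x - matrix h *v x \<in> F\<^sup>\<bottom>" using h by simp
  moreover have "P = P'" if "\<forall>x. P *v x \<in> F \<and> x - P *v x \<in> F\<^sup>\<bottom>"
      "\<forall>x. P' *v x \<in> F \<and> x - P' *v x \<in> F\<^sup>\<bottom>" for P P' :: "real^'n^'n"
    using that uniq by (subst matrix_eq) blast
  ultimately show ?thesis by blast
qed

lemma proj_matrix:
  assumes "subspace F"
  shows "proj_matrix F *v x \<in> F" "x - proj_matrix F *v x \<in> F\<^sup>\<bottom>"
  using theI'[OF ex1_proj_matrix[OF assms]] unfolding proj_matrix_def by blast+

lemma GDERIV_grad:
  fixes f :: "'a::euclidean_space \<Rightarrow> real"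
  assumes "f differentiable (at x)"
  shows "GDERIV f x :> grad f x"
proof -
  obtain D where D: "(f has_derivative D) (at x)"
    using assms by (auto simp: differentiable_def)
  then have lin: "linear D" by (rule has_derivative_linear)
  have "D = (\<lambda>h. h \<bullet> adjoint D 1)"
    using adjoint_works[OF lin, of _ 1] by (auto simp: fun_eq_iff inner_commute)
  then have ex: "GDERIV f x :> adjoint D 1"
    using D unfolding gderiv_def by simp
  have "D1 = D2" if "GDERIV f x :> D1" "GDERIV f x :> D2" for D1 D2
  proof -
    have "(\<lambda>h. h \<bullet> D1) = (\<lambda>h. h \<bullet> D2)"
      using that unfolding gderiv_def by (rule has_derivative_unique)
    then have "(D1 - D2) \<bullet> (D1 - D2) = 0"
      by (metis inner_diff_right right_minus_eq)
    then show ?thesis by simp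
  qed
  with ex have "\<exists>!D. GDERIV f x :> D" by blast
  then show ?thesis unfolding grad_def by (rule theI')
qed

lemma space_subspace_algebra: "space subspace_algebra = {F. subspace F}"
  by (simp add: subspace_algebra_def)

lemma measurable_proj_matrix: "proj_matrix \<in> measurable subspace_algebra borel"
  unfolding subspace_algebra_def by (rule measurable_vimage_algebra1) auto

end

theory Submission
  imports Defs
begin

text \<open>
  The algorithm is a randomized fixed-point iteration.  Write \<open>R = matrix_sqrt P\<close>, so that \<open>Q\<close> is the
  inverse of \<open>R\<close>, let \<open>F u = u - \<gamma> \<nabla>f(u)\<close>, and let \<open>T v = Q F (prox (R v))\<close>.  Then \<open>y k = T (z (k - 1))\<close>,
  so \<open>z k\<close> arises from \<open>z (k - 1)\<close> by replacing its component in the random subspace \<open>S k\<close> by that of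
  \<open>T (z (k - 1))\<close>.  Since \<open>xstar\<close> minimizes \<open>f + g\<close>, it equals \<open>prox (F xstar)\<close>, and so
  \<open>zs = Q F xstar\<close> is a fixed point of \<open>T\<close> that \<open>prox \<circ> R\<close> maps to \<open>xstar\<close>.

  Put \<open>a = T (z (k - 1)) - zs\<close> and \<open>b = z (k - 1) - zs\<close>.  By Pythagoras, with \<open>X\<close> the projection onto \<open>S k\<close>,
  the squared distance of \<open>z k\<close> to \<open>zs\<close> is \<open>a \<bullet> X a + b \<bullet> b - b \<bullet> X b\<close>.  As \<open>S k\<close> is independent of the past,
  taking expectations turns \<open>X\<close> into its mean \<open>P\<close>.  The scaling by \<open>Q\<close> is chosen for exactly this
  moment: \<open>v \<bullet> P v\<close> is the squared norm of \<open>R v\<close>, and in this norm \<open>T\<close> is a contraction, because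
  \<open>R (T v - T w) = F (prox (R v)) - F (prox (R w))\<close>, the proximity operator is nonexpansive and the
  gradient step \<open>F\<close> shrinks squared distances by the factor \<open>1 - \<alpha>\<close> with \<open>\<alpha> = 2 \<gamma> \<mu> L / (\<mu> + L)\<close>.
  Hence \<open>E (a \<bullet> P a) \<le> (1 - \<alpha>) E (b \<bullet> P b)\<close>, and one step decreases the expected squared distance
  by \<open>\<alpha> E (b \<bullet> P b) \<ge> \<alpha> \<lambda>_min E (b \<bullet> b)\<close>.  This is \<open>expected_distance_geometric\<close>.  Going from \<open>z k\<close> to
  \<open>x (k + 1) = prox (R (z k))\<close> costs the factor \<open>\<lambda>_max\<close>, once.  Almost sure convergence follows
  because a geometric bound makes the expected squared errors summable.

  Three classical facts carry this argument: the interpolation inequality for smooth strongly convex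
  functions (\<open>interpolation_inequality\<close>), existence and nonexpansiveness of the proximity operator
  (\<open>prox_minimizer\<close>, \<open>prox_nonexpansive\<close>), and the spectral theorem for symmetric matrices
  (\<open>orthonormal_eigenbasis_exists_on_subspace\<close>), which yields the Rayleigh bounds and the square root.
\<close>

section \<open>Gradient steps for smooth strongly convex functions\<close>

lemma GDERIV_along_line:
  assumes "GDERIV h (p + t *\<^sub>R d) :> D"
  shows "((\<lambda>t. h (p + t *\<^sub>R d)) has_real_derivative d \<bullet> D) (at t)"
proof -
  have "((\<lambda>t. p + t *\<^sub>R d) has_derivative (\<lambda>s. s *\<^sub>R d)) (at t)"
    by (auto intro!: derivative_eq_intros)
  then have "((\<lambda>t. h (p + t *\<^sub>R d)) has_derivative (\<lambda>s. (s *\<^sub>R d) \<bullet> D)) (at t)"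
    by (rule has_derivative_compose) (use assms in \<open>simp add: gderiv_def\<close>)
  then show ?thesis
    by (simp add: has_field_derivative_def mult.commute[of _ "d \<bullet> D"])
qed

text \<open>Convexity inequalities bound a function along a segment from one end only; this is the
  form in which they pass to the derivative at that end.\<close>

lemma derivative_ge_slope_right:
  fixes \<phi> :: "real \<Rightarrow> real"
  assumes der: "(\<phi> has_real_derivative D) (at 0)"
    and slope: "\<And>t. 0 < t \<Longrightarrow> t < 1 \<Longrightarrow> \<phi> 0 + t * c \<le> \<phi> t"
  shows "c \<le> D"
proof -
  have "((\<lambda>t. (\<phi> t - \<phi> 0) / (t - 0)) \<longlongrightarrow> D) (at 0)"
    using der by (simp add: has_field_derivative_iff)
  then have lim: "((\<lambda>t. (\<phi> t - \<phi> 0) / t) \<longlongrightarrow> D) (at_right 0)"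
    by (auto intro: tendsto_within_subset)
  have "\<forall>\<^sub>F t in at_right (0::real). c \<le> (\<phi> t - \<phi> 0) / t"
    using eventually_at_right_less[of 0] eventually_at_right[of 0 1 "\<lambda>t. t < 1"]
    by (auto simp: eventually_at_right_field field_simps intro!: exI[of _ 1] dest: slope)
  then show ?thesis
    by (rule tendsto_lowerbound[OF lim]) simp
qed

text \<open>First-order optimality: moving from the minimizer \<open>p\<close> a fraction
  \<open>t\<close> of the way towards \<open>y\<close> changes \<open>g\<close> by at most
  \<open>t (g y - g p)\<close> because of convexity, and \<open>h\<close> by \<open>t D \<bullet>
  (y - p)\<close> up to \<open>o(t)\<close>; the sum cannot be negative. So \<open>- D\<close> is
  a subgradient of \<open>g\<close> at \<open>p\<close>.\<close>

lemma convex_subgradient_at_composite_minimizer: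
  fixes p :: "'a::real_inner"
  assumes h: "GDERIV h p :> D" and g: "convex_fun g" and no_minf: "\<And>y. g y \<noteq> -\<infinity>"
    and fin: "g p = ereal s"
    and min: "\<And>y. ereal (h p) + g p \<le> ereal (h y) + g y"
  shows "g y \<ge> ereal (s - D \<bullet> (y - p))"
proof (cases "g y")
  case (real r)
  have "s - r \<le> (y - p) \<bullet> D"
  proof (rule derivative_ge_slope_right)
    show "((\<lambda>t. h (p + t *\<^sub>R (y - p))) has_real_derivative (y - p) \<bullet> D) (at 0)"
      by (rule GDERIV_along_line) (use h in simp)
  next
    fix t :: real assume t: "0 < t" "t < 1"
    have "g ((1 - t) *\<^sub>R p + t *\<^sub>R y) \<le> ereal (1 - t) * g p + ereal t * g y"
      using g t unfolding convex_fun_def by auto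
    moreover have "(1 - t) *\<^sub>R p + t *\<^sub>R y = p + t *\<^sub>R (y - p)"
      by (simp add: algebra_simps)
    ultimately have "g (p + t *\<^sub>R (y - p)) \<le> ereal ((1 - t) * s + t * r)"
      using fin real by simp
    then have "ereal (h p) + g p \<le> ereal (h (p + t *\<^sub>R (y - p))) + ereal ((1 - t) * s + t * r)"
      using min[of "p + t *\<^sub>R (y - p)"] add_left_mono order_trans by blast
    then show "h (p + 0 *\<^sub>R (y - p)) + t * (s - r) \<le> h (p + t *\<^sub>R (y - p))"
      using fin by (simp add: algebra_simps)
  qed
  then show ?thesis using real by (simp add: inner_commute)
qed (use no_minf in auto)

text \<open>Divide the defining inequality on the segment from \<open>x\<close> to
  \<open>y\<close> by the step length and let it tend to zero.\<close>

lemma strongly_convex_first_order: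
  fixes f :: "'a::euclidean_space \<Rightarrow> real"
  assumes f: "strongly_convex \<mu> f" and D: "GDERIV f x :> D"
  shows "f y \<ge> f x + D \<bullet> (y - x) + \<mu> / 2 * (norm (y - x))\<^sup>2"
proof -
  \<comment> \<open>The quadratic term is moved into \<open>\<phi>\<close>, which makes the remaining bound linear in \<open>t\<close>.\<close>
  define \<phi> where "\<phi> t = - f (x + t *\<^sub>R (y - x)) - \<mu> / 2 * (1 - t) * t * (norm (y - x))\<^sup>2" for t
  have "f x - f y \<le> - ((y - x) \<bullet> D) - \<mu> / 2 * (norm (y - x))\<^sup>2"
  proof (rule derivative_ge_slope_right)
    have "((\<lambda>t. f (x + t *\<^sub>R (y - x))) has_real_derivative (y - x) \<bullet> D) (at 0)"
      by (rule GDERIV_along_line) (use D in simp)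
    then show "(\<phi> has_real_derivative - ((y - x) \<bullet> D) - \<mu> / 2 * (norm (y - x))\<^sup>2) (at 0)"
      unfolding \<phi>_def by (auto intro!: derivative_eq_intros)
  next
    fix t :: real assume t: "0 < t" "t < 1"
    have "f ((1 - t) *\<^sub>R x + t *\<^sub>R y) \<le> (1 - t) * f x + t * f y - \<mu> / 2 * (1 - t) * t * (norm (x - y))\<^sup>2"
      using f t unfolding strongly_convex_def by auto
    moreover have "(1 - t) *\<^sub>R x + t *\<^sub>R y = x + t *\<^sub>R (y - x)"
      by (simp add: algebra_simps)
    ultimately show "\<phi> 0 + t * (f x - f y) \<le> \<phi> t"
      by (simp add: \<phi>_def algebra_simps norm_minus_commute)
  qed
  then show ?thesis by (simp add: inner_commute)
qed

lemma descent_lemma: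
  fixes f :: "'a::euclidean_space \<Rightarrow> real"
  assumes D: "\<And>u. GDERIV f u :> G u" and lip: "\<And>u v. norm (G u - G v) \<le> L * norm (u - v)"
  shows "f y \<le> f x + G x \<bullet> (y - x) + L / 2 * (norm (y - x))\<^sup>2"
proof -
  define d where "d = y - x"
  define \<psi> where "\<psi> t = f (x + t *\<^sub>R d) - t * (G x \<bullet> d) - L / 2 * t\<^sup>2 * (norm d)\<^sup>2" for t
  \<comment> \<open>\<open>\<psi>\<close> is the defect along the segment; the Lipschitz bound makes its derivative nonpositive.\<close>
  have "\<psi> 1 \<le> \<psi> 0"
  proof (rule DERIV_nonpos_imp_nonincreasing[where f = \<psi>])
    fix t :: real assume t: "0 \<le> t" "t \<le> 1"
    have "(\<psi> has_real_derivative d \<bullet> G (x + t *\<^sub>R d) - G x \<bullet> d - L * t * (norm d)\<^sup>2) (at t)"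
      unfolding \<psi>_def
      by (auto intro!: derivative_eq_intros GDERIV_along_line D)
    moreover have "d \<bullet> G (x + t *\<^sub>R d) - G x \<bullet> d - L * t * (norm d)\<^sup>2 \<le> 0"
    proof -
      have "d \<bullet> (G (x + t *\<^sub>R d) - G x) \<le> norm d * norm (G (x + t *\<^sub>R d) - G x)"
        by (rule norm_cauchy_schwarz)
      also have "\<dots> \<le> norm d * (L * norm ((x + t *\<^sub>R d) - x))"
        by (rule mult_left_mono[OF lip norm_ge_zero])
      also have "\<dots> = L * t * (norm d)\<^sup>2"
        using t by (simp add: power2_eq_square)
      finally show ?thesis by (simp add: inner_diff_right inner_commute)
    qed
    ultimately show "\<exists>z. (\<psi> has_real_derivative z) (at t) \<and> z \<le> 0"
      by blast
  qed simp
  then show ?thesis by (simp add: \<psi>_def d_def)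
qed

lemma norm_diff_scaleR_squared:
  fixes v w :: "'a::real_inner"
  shows "(norm (v - c *\<^sub>R w))\<^sup>2 = (norm v)\<^sup>2 - 2 * c * (w \<bullet> v) + c\<^sup>2 * (norm w)\<^sup>2"
  unfolding power2_norm_eq_inner
  by (simp add: inner_diff_left inner_diff_right inner_commute power2_eq_square algebra_simps)

text \<open>The theorem of Baillon and Haddad. The two bounds are what convexity and a
  \<open>K\<close>-Lipschitz gradient give. Follow the gradient of \<open>y \<mapsto> \<phi> y - G
  a \<bullet> y\<close> downhill from \<open>b\<close> by a step \<open>t\<close>: the upper bound
  at \<open>b\<close> guarantees a decrease of \<open>(t - K t\<^sup>2 / 2) * (norm (G b - G
  a))\<^sup>2\<close>, while the lower bound at \<open>a\<close> limits how far the value can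
  drop. Adding the two inequalities obtained by exchanging \<open>a\<close> and \<open>b\<close>
  gives the claim for the best step \<open>t = 1 / K\<close>.\<close>

lemma cocoercivity:
  fixes G :: "'a::real_inner \<Rightarrow> 'a"
  assumes lower: "\<And>x y. \<phi> y \<ge> \<phi> x + G x \<bullet> (y - x)"
    and upper: "\<And>x y. \<phi> y \<le> \<phi> x + G x \<bullet> (y - x) + K / 2 * (norm (y - x))\<^sup>2"
  shows "(norm (G u - G v))\<^sup>2 \<le> K * ((G u - G v) \<bullet> (u - v))"
proof (cases "u = v")
  case False
  have "0 \<le> K / 2 * (norm (u - v))\<^sup>2"
    using lower[of u v] upper[of v u] by (simp add: norm_minus_commute)
  then have K: "0 \<le> K"
    using False by (simp add: zero_le_mult_iff)
  have half: "\<phi> b - \<phi> a - G a \<bullet> (b - a) \<ge> (t - K / 2 * t\<^sup>2) * (norm (G b - G a))\<^sup>2" for a b t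
  proof -
    define w where "w = b - t *\<^sub>R (G b - G a)"
    have "\<phi> a + G a \<bullet> (w - a) \<le> \<phi> b + G b \<bullet> (w - b) + K / 2 * (norm (w - b))\<^sup>2"
      using lower[where x = a and y = w] upper[where x = b and y = w] by linarith
    moreover have "G a \<bullet> (w - a) = G a \<bullet> (b - a) - t * (G a \<bullet> (G b - G a))"
      by (simp add: w_def algebra_simps)
    moreover have "G b \<bullet> (w - b) = - t * (G b \<bullet> (G b - G a))"
      by (simp add: w_def)
    moreover have "(norm (w - b))\<^sup>2 = t\<^sup>2 * (norm (G b - G a))\<^sup>2"
      by (simp add: w_def power_mult_distrib norm_minus_commute)
    moreover have "(norm (G b - G a))\<^sup>2 = G b \<bullet> (G b - G a) - G a \<bullet> (G b - G a)"
      by (simp add: power2_norm_eq_inner inner_diff_left)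
    moreover have "t * (norm (G b - G a))\<^sup>2 = t * (G b \<bullet> (G b - G a)) - t * (G a \<bullet> (G b - G a))"
      using calculation(5) by (simp add: right_diff_distrib)
    ultimately show ?thesis by (simp add: left_diff_distrib mult.assoc)
  qed
  have step: "(2 * t - K * t\<^sup>2) * (norm (G u - G v))\<^sup>2 \<le> (G u - G v) \<bullet> (u - v)" for t
    using half[of t v u] half[of t u v]
    by (simp add: algebra_simps inner_diff_left inner_diff_right norm_minus_commute)
  show ?thesis
  proof (cases "K = 0")
    case True
    define e m where "e = (norm (G u - G v))\<^sup>2" and "m = (G u - G v) \<bullet> (u - v)"
    \<comment> \<open>Now \<open>\<phi>\<close> is affine and every step is admissible, so a long one forces the gradients to agree.\<close>
    have "2 * t * e \<le> m" for t
      using step[of t] True by (simp add: e_def m_def)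
    then have "e \<le> 0"
      using \<open>\<And>t. 2 * t * e \<le> m\<close>[of "(m + 1) / (2 * e)"] by (cases "e = 0") (auto simp: e_def)
    then show ?thesis using True by (simp add: e_def)
  next
    case False
    have "(2 * (1 / K) - K * (1 / K)\<^sup>2) = 1 / K"
      using False by (simp add: power2_eq_square field_simps)
    with step[of "1 / K"] have "1 / K * (norm (G u - G v))\<^sup>2 \<le> (G u - G v) \<bullet> (u - v)" by simp
    then show ?thesis using False K by (simp add: field_simps)
  qed
qed simp

locale smooth_strongly_convex =
  fixes f :: "'a::euclidean_space \<Rightarrow> real" and L \<mu> :: real
  assumes smooth: "smooth_with L f" and sc: "strongly_convex \<mu> f" and mu_pos: "0 < \<mu>"
begin

lemma GDERIV_f: "GDERIV f x :> grad f x"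
  using smooth GDERIV_grad unfolding smooth_with_def by blast

lemma lipschitz_grad: "norm (grad f u - grad f v) \<le> L * norm (u - v)"
  using smooth unfolding smooth_with_def lipschitz_on_def by (simp add: dist_norm)

lemma modulus_le_smoothness: "\<mu> \<le> L"
proof -
  obtain b :: 'a where b: "b \<in> Basis" using nonempty_Basis by blast
  have "\<mu> / 2 * (norm (b - 0))\<^sup>2 \<le> L / 2 * (norm (b - 0))\<^sup>2"
    using descent_lemma[of f "grad f", OF GDERIV_f lipschitz_grad, of b 0]
      strongly_convex_first_order[OF sc GDERIV_f, of 0 b] by linarith
  then show ?thesis using b by simp
qed

text \<open>Subtracting \<open>\<mu> / 2 * (x \<bullet> x)\<close> from \<open>f\<close> leaves a
  convex function that satisfies the quadratic upper bound with constant \<open>L - \<mu>\<close>;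
  the inequality is \<open>cocoercivity\<close> for that function, multiplied out.\<close>

lemma interpolation_inequality:
  "(\<mu> + L) * ((grad f u - grad f v) \<bullet> (u - v))
     \<ge> (norm (grad f u - grad f v))\<^sup>2 + \<mu> * L * (norm (u - v))\<^sup>2"
proof -
  define \<phi> where "\<phi> x = f x - \<mu> / 2 * (x \<bullet> x)" for x
  define G where "G x = grad f x - \<mu> *\<^sub>R x" for x
  have expand: "\<phi> y - \<phi> x - G x \<bullet> (y - x)
      = f y - f x - grad f x \<bullet> (y - x) - \<mu> / 2 * (norm (y - x))\<^sup>2" for x y
    unfolding \<phi>_def G_def power2_norm_eq_inner inner_diff_left inner_diff_right inner_scaleR_left
    by (simp add: inner_commute[of y x] field_simps)
  have "\<phi> y \<ge> \<phi> x + G x \<bullet> (y - x)" for x y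
    using expand[of y x] strongly_convex_first_order[OF sc GDERIV_f, of x y] by linarith
  moreover have "\<phi> y \<le> \<phi> x + G x \<bullet> (y - x) + (L - \<mu>) / 2 * (norm (y - x))\<^sup>2" for x y
    using expand[of y x] descent_lemma[of f "grad f", OF GDERIV_f lipschitz_grad, of y x]
    by (simp add: field_simps)
  ultimately have coco: "(norm (G u - G v))\<^sup>2 \<le> (L - \<mu>) * ((G u - G v) \<bullet> (u - v))"
    by (rule cocoercivity)
  define d w where "d = grad f u - grad f v" and "w = u - v"
  have Gd: "G u - G v = d - \<mu> *\<^sub>R w"
    by (simp add: G_def d_def w_def algebra_simps)
  have "(d - \<mu> *\<^sub>R w) \<bullet> w = d \<bullet> w - \<mu> * (norm w)\<^sup>2"
    by (simp add: power2_norm_eq_inner inner_diff_left)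
  with coco have "(norm d)\<^sup>2 - 2 * \<mu> * (d \<bullet> w) + \<mu>\<^sup>2 * (norm w)\<^sup>2
      \<le> (L - \<mu>) * (d \<bullet> w - \<mu> * (norm w)\<^sup>2)"
    unfolding Gd norm_diff_scaleR_squared w_def[symmetric] by (simp add: inner_commute)
  then show ?thesis
    unfolding d_def[symmetric] w_def[symmetric] by (simp add: algebra_simps power2_eq_square)
qed

text \<open>Expand the square and use \<open>interpolation_inequality\<close> on the mixed term.
  What remains of the squared gradient difference has the factor \<open>\<gamma> * (\<gamma> - 2 /
  (\<mu> + L))\<close>, and the bound on the stepsize is exactly what makes it
  nonpositive.\<close>

lemma forward_step_contraction:
  assumes \<gamma>: "0 < \<gamma>" "\<gamma> \<le> 2 / (\<mu> + L)"
  shows "(norm ((u - \<gamma> *\<^sub>R grad f u) - (v - \<gamma> *\<^sub>R grad f v)))\<^sup>2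
    \<le> (1 - 2 * \<gamma> * \<mu> * L / (\<mu> + L)) * (norm (u - v))\<^sup>2"
proof -
  define d w where "d = grad f u - grad f v" and "w = u - v"
  have pos: "0 < \<mu> + L" using mu_pos modulus_le_smoothness by linarith
  have "(norm ((u - \<gamma> *\<^sub>R grad f u) - (v - \<gamma> *\<^sub>R grad f v)))\<^sup>2 = (norm (w - \<gamma> *\<^sub>R d))\<^sup>2"
    by (simp add: d_def w_def algebra_simps)
  also have "\<dots> = (norm w)\<^sup>2 - 2 * \<gamma> * (d \<bullet> w) + \<gamma>\<^sup>2 * (norm d)\<^sup>2"
    by (rule norm_diff_scaleR_squared)
  also have "\<dots> \<le> (norm w)\<^sup>2 - 2 * \<gamma> * (((norm d)\<^sup>2 + \<mu> * L * (norm w)\<^sup>2) / (\<mu> + L)) + \<gamma>\<^sup>2 * (norm d)\<^sup>2"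
  proof -
    have "((norm d)\<^sup>2 + \<mu> * L * (norm w)\<^sup>2) / (\<mu> + L) \<le> d \<bullet> w"
      using interpolation_inequality[of u v] pos
      by (simp add: d_def w_def pos_divide_le_eq mult.commute)
    then have "2 * \<gamma> * (((norm d)\<^sup>2 + \<mu> * L * (norm w)\<^sup>2) / (\<mu> + L)) \<le> 2 * \<gamma> * (d \<bullet> w)"
      using less_imp_le[OF \<gamma>(1)] by (intro mult_left_mono mult_nonneg_nonneg) auto
    then show ?thesis by (intro add_right_mono diff_left_mono)
  qed
  also have "\<dots> = (1 - 2 * \<gamma> * \<mu> * L / (\<mu> + L)) * (norm w)\<^sup>2 - \<gamma> * (2 / (\<mu> + L) - \<gamma>) * (norm d)\<^sup>2"
  proof -
    have "a - 2 * \<gamma> * ((b + m * a) * \<kappa>) + \<gamma>\<^sup>2 * b = (1 - 2 * \<gamma> * m * \<kappa>) * a - \<gamma> * (2 * \<kappa> - \<gamma>) * b"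
      for a b m \<kappa> by (simp add: algebra_simps power2_eq_square)
    from this[of "(norm w)\<^sup>2" "(norm d)\<^sup>2" "\<mu> * L" "1 / (\<mu> + L)"] show ?thesis
      by (simp add: mult.assoc)
  qed
  also have "\<dots> \<le> (1 - 2 * \<gamma> * \<mu> * L / (\<mu> + L)) * (norm w)\<^sup>2"
    unfolding diff_le_eq le_add_same_cancel1
    using \<gamma> by (intro mult_nonneg_nonneg) (auto intro: less_imp_le)
  finally show ?thesis by (simp add: w_def)
qed

text \<open>The factor of \<open>forward_step_contraction\<close> bounds a square from above, so
  it is nonnegative.\<close>

lemma rate_bounds:
  assumes \<gamma>: "0 < \<gamma>" "\<gamma> \<le> 2 / (\<mu> + L)"
  shows "0 < 2 * \<gamma> * \<mu> * L / (\<mu> + L)" "2 * \<gamma> * \<mu> * L / (\<mu> + L) \<le> 1"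
proof -
  have L: "0 < L" using mu_pos modulus_le_smoothness by linarith
  show "0 < 2 * \<gamma> * \<mu> * L / (\<mu> + L)"
    using mu_pos L \<gamma>(1) by (intro divide_pos_pos mult_pos_pos add_pos_pos) auto
  obtain b :: 'a where "b \<in> Basis" using nonempty_Basis by blast
  then have nb: "(norm (b - 0))\<^sup>2 = 1" by simp
  have "0 \<le> (1 - 2 * \<gamma> * \<mu> * L / (\<mu> + L)) * (norm (b - 0))\<^sup>2"
    by (rule order_trans[OF zero_le_power2 forward_step_contraction[OF \<gamma>, of b 0]])
  then show "2 * \<gamma> * \<mu> * L / (\<mu> + L) \<le> 1" unfolding nb mult_1_right le_diff_eq add_0 .
qed

end

section \<open>The proximity operator\<close>

text \<open>The level \<open>c\<close> is real so that the real summand can be moved to the other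
  side without meeting \<open>\<infinity> - \<infinity>\<close>.\<close>

lemma open_strict_superlevel_lsc_plus_continuous:
  fixes g :: "'a::metric_space \<Rightarrow> ereal"
  assumes g: "lsc_fun g" and q: "continuous_on UNIV q"
  shows "open {y. ereal c < g y + ereal (q y)}"
proof -
  have "\<exists>T. open T \<and> x \<in> T \<and> T \<subseteq> {y. ereal c < g y + ereal (q y)}"
    if x: "ereal c < g x + ereal (q x)" for x
  proof -
    have eq: "ereal c < g y + ereal (q y) \<longleftrightarrow> ereal (c - q y) < g y" for y
      by (cases "g y") auto
    obtain r where r: "c - q x < r" "ereal r < g x"
      using x ereal_dense2[of "ereal (c - q x)" "g x"] by (auto simp: eq)
    have "ereal r < Liminf (at x) g"
      using r(2) g unfolding lsc_fun_def by (meson less_le_trans)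
    then have "\<forall>\<^sub>F y in at x. ereal r < g y"
      by (rule less_LiminfD)
    then have "\<forall>\<^sub>F y in nhds x. ereal r < g y"
      using r(2) by (auto simp: eventually_at_filter elim: eventually_mono)
    moreover have "\<forall>\<^sub>F y in nhds x. c - q y < r"
    proof -
      have "(q \<longlongrightarrow> q x) (nhds x)"
        using q by (simp add: continuous_on_eq_continuous_at isCont_def tendsto_at_iff_tendsto_nhds)
      then have "((\<lambda>y. c - q y) \<longlongrightarrow> c - q x) (nhds x)"
        by (intro tendsto_diff tendsto_const)
      then show ?thesis using r(1) by (rule order_tendstoD)
    qed
    ultimately have "\<forall>\<^sub>F y in nhds x. ereal c < g y + ereal (q y)"
    proof eventually_elim
      case (elim y)
      then have "ereal (c - q y) < ereal r" by simp
      then show ?case using elim(1) unfolding eq by (rule less_trans)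
    qed
    then show ?thesis
      unfolding eventually_nhds by blast
  qed
  then show ?thesis by (subst open_subopen) blast
qed

text \<open>The sublevel sets through the points of the compact one are closed and totally ordered
  by inclusion, so they have the finite intersection property; a common point is a
  minimizer.\<close>

lemma lsc_attains_min_compact_sublevel:
  fixes F :: "'a::t2_space \<Rightarrow> ereal"
  assumes closed: "\<And>c. closed {y. F y \<le> ereal c}" and no_minf: "\<And>y. F y \<noteq> -\<infinity>"
    and F0: "F x0 = ereal c0" and compact: "compact {y. F y \<le> F x0}"
  shows "\<exists>p. \<forall>y. F p \<le> F y"
proof -
  define K where "K = {y. F y \<le> F x0}"
  define A where "A = (\<lambda>y. {v. F v \<le> F y}) ` K"
  have "K \<inter> \<Inter>A \<noteq> {}"
  proof (rule compact_imp_fip)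
    show "compact K" using compact by (simp add: K_def)
    show "closed T" if T: "T \<in> A" for T
    proof -
      obtain y where y: "F y \<le> F x0" "T = {v. F v \<le> F y}"
        using T by (auto simp: A_def K_def)
      then obtain c where "F y = ereal c"
        using F0 no_minf[of y] by (cases "F y") auto
      then show ?thesis using y closed by simp
    qed
    fix A' assume A': "finite A'" "A' \<subseteq> A"
    then obtain Y where Y: "finite Y" "Y \<subseteq> K" "A' = (\<lambda>y. {v. F v \<le> F y}) ` Y"
      unfolding A_def by (metis finite_subset_image)
    show "K \<inter> \<Inter>A' \<noteq> {}"
    proof (cases "Y = {}")
      case True
      have "x0 \<in> K" by (simp add: K_def)
      with True Y show ?thesis by auto
    next
      case False
      obtain p where "p \<in> Y" "\<forall>y\<in>Y. F p \<le> F y"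
        using ex_min_if_finite[of "F ` Y"] Y(1) False by (auto simp: not_less)
      with Y show ?thesis by blast
    qed
  qed
  then obtain p where p: "p \<in> K" "\<forall>y\<in>K. F p \<le> F y" by (auto simp: A_def)
  have "F p \<le> F y" for y
  proof (cases "y \<in> K")
    case False
    then have "F x0 \<le> F y" by (simp add: K_def)
    moreover have "F p \<le> F x0" using p(1) by (simp add: K_def)
    ultimately show ?thesis by (rule order_trans[rotated])
  qed (use p in blast)
  then show ?thesis by blast
qed

text \<open>An affine minorant of \<open>g\<close> touching it at \<open>x0\<close> makes the
  objective of the proximity operator coercive. Every proper lower semicontinuous convex function
  has an affine minorant, but proving that needs a separation theorem; here the minimizer of
  \<open>f + g\<close> supplies one at once, see
  \<open>prox_regularization_at_composite_minimizer\<close>. The same minorant shows that the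
  minimizer is a fixed point.\<close>

locale prox_regularization =
  fixes g :: "'a::euclidean_space \<Rightarrow> ereal" and x0 d0 :: 'a and s0 :: real
  assumes g_convex: "convex_fun g" and g_proper: "proper_fun g" and g_lsc: "lsc_fun g"
    and g_x0: "g x0 = ereal s0"
    and minorant: "\<And>y. g y \<ge> ereal (s0 + d0 \<bullet> (y - x0))"
begin

lemma g_no_minf: "g y \<noteq> -\<infinity>"
  using g_proper by (simp add: proper_fun_def)

text \<open>The definition of \<open>prox\<close> chooses some minimizer, so its existence has to
  be shown. The quadratic outgrows the affine minorant, hence the sublevel set through
  \<open>x0\<close> is compact.\<close>

lemma prox_minimizer:
  assumes \<gamma>: "0 < \<gamma>"
  shows "g (prox \<gamma> g u) + ereal (1 / (2 * \<gamma>) * (norm (prox \<gamma> g u - u))\<^sup>2)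
    \<le> g y + ereal (1 / (2 * \<gamma>) * (norm (y - u))\<^sup>2)"
proof -
  define q where "q y = 1 / (2 * \<gamma>) * (norm (y - u))\<^sup>2" for y
  define F where "F y = g y + ereal (q y)" for y
  have q: "continuous_on UNIV q"
    unfolding q_def by (intro continuous_intros)
  have closed: "closed {y. F y \<le> ereal c}" for c
  proof -
    have "{y. F y \<le> ereal c} = - {y. ereal c < F y}" by auto
    then show ?thesis
      using open_strict_superlevel_lsc_plus_continuous[OF g_lsc q, of c]
      by (simp add: F_def closed_def)
  qed
  have F0: "F x0 = ereal (s0 + q x0)" by (simp add: F_def g_x0)
  \<comment> \<open>On the sublevel set the squared distance \<open>r\<^sup>2\<close> to \<open>u\<close> is at most \<open>2 \<gamma> (const + norm d0 * r)\<close>, so \<open>r \<le> 1\<close> or \<open>r \<le> 2 \<gamma> N\<close>.\<close>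
  define N where "N = \<bar>q x0 + d0 \<bullet> (x0 - u)\<bar> + norm d0"
  have "{y. F y \<le> F x0} \<subseteq> cball u (1 + 2 * \<gamma> * N)"
  proof
    fix y assume "y \<in> {y. F y \<le> F x0}"
    then have "g y + ereal (q y) \<le> ereal (s0 + q x0)" by (simp add: F0[symmetric] F_def)
    moreover have "ereal (s0 + d0 \<bullet> (y - x0) + q y) \<le> g y + ereal (q y)"
      using add_right_mono[OF minorant[of y], of "ereal (q y)"] by simp
    ultimately have "q y \<le> q x0 - d0 \<bullet> (y - x0)"
      by (smt (verit, best) ereal_less_eq(3) order_trans)
    also have "\<dots> = (q x0 + d0 \<bullet> (x0 - u)) - d0 \<bullet> (y - u)"
      by (simp add: inner_diff_right)
    also have "\<dots> \<le> \<bar>q x0 + d0 \<bullet> (x0 - u)\<bar> + norm d0 * norm (y - u)"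
      using Cauchy_Schwarz_ineq2[of d0 "y - u"] by linarith
    finally have 1: "q y \<le> \<bar>q x0 + d0 \<bullet> (x0 - u)\<bar> + norm d0 * norm (y - u)" .
    have "norm (y - u) \<le> 1 + 2 * \<gamma> * N"
    proof (cases "norm (y - u) \<le> 1")
      case True
      then show ?thesis using \<gamma> by (simp add: N_def add_increasing2)
    next
      case False
      then have "q y \<le> N * norm (y - u)"
        using 1 mult_left_mono[of 1 "norm (y - u)" "\<bar>q x0 + d0 \<bullet> (x0 - u)\<bar>"]
        by (simp add: N_def distrib_right)
      then have "norm (y - u) * norm (y - u) \<le> (2 * \<gamma> * N) * norm (y - u)"
        using \<gamma> by (simp add: q_def power2_eq_square field_simps)
      then have "norm (y - u) \<le> 2 * \<gamma> * N"
        using False by (subst (asm) mult_le_cancel_right) auto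
      then show ?thesis by simp
    qed
    then show "y \<in> cball u (1 + 2 * \<gamma> * N)" by (simp add: dist_norm norm_minus_commute)
  qed
  then have "bounded {y. F y \<le> F x0}" by (rule bounded_subset[OF bounded_cball])
  then have "compact {y. F y \<le> F x0}"
    using closed F0 by (simp add: compact_eq_bounded_closed)
  moreover have "F y \<noteq> -\<infinity>" for y
    using g_no_minf[of y] by (cases "g y") (auto simp: F_def)
  ultimately obtain p where "\<forall>y. F p \<le> F y"
    using lsc_attains_min_compact_sublevel[OF closed] F0 by metis
  then have "is_arg_min F (\<lambda>_. True) p" by (auto simp: is_arg_min_def not_less)
  then have "is_arg_min F (\<lambda>_. True) (prox \<gamma> g u)"
    unfolding prox_def arg_min_def F_def q_def by (rule someI)
  then show ?thesis by (auto simp: is_arg_min_def not_less F_def q_def)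
qed

lemma prox_subgradient:
  assumes \<gamma>: "0 < \<gamma>"
  obtains s where "g (prox \<gamma> g u) = ereal s"
    "\<And>y. g y \<ge> ereal (s + (1 / \<gamma>) * ((u - prox \<gamma> g u) \<bullet> (y - prox \<gamma> g u)))"
proof -
  define p where "p = prox \<gamma> g u"
  have min: "ereal (1 / (2 * \<gamma>) * (norm (p - u))\<^sup>2) + g p
      \<le> ereal (1 / (2 * \<gamma>) * (norm (y - u))\<^sup>2) + g y" for y
    using prox_minimizer[OF \<gamma>, of u y] by (simp add: p_def add.commute)
  obtain s where s: "g p = ereal s"
    using min[of x0] g_x0 g_no_minf[of p] by (cases "g p") auto
  have "GDERIV (\<lambda>y. 1 / (2 * \<gamma>) * (norm (y - u))\<^sup>2) p :> (1 / \<gamma>) *\<^sub>R (p - u)"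
    unfolding gderiv_def power2_norm_eq_inner using \<gamma>
    by (auto intro!: derivative_eq_intros simp: fun_eq_iff inner_commute)
  from convex_subgradient_at_composite_minimizer[OF this g_convex g_no_minf s min]
  have "g y \<ge> ereal (s - ((1 / \<gamma>) *\<^sub>R (p - u)) \<bullet> (y - p))" for y .
  moreover have "s - ((1 / \<gamma>) *\<^sub>R (p - u)) \<bullet> (y - p) = s + (1 / \<gamma>) * ((u - p) \<bullet> (y - p))" for y
    by (simp add: inner_diff_left algebra_simps diff_divide_distrib)
  ultimately have "g y \<ge> ereal (s + (1 / \<gamma>) * ((u - p) \<bullet> (y - p)))" for y
    by metis
  then show ?thesis using s that unfolding p_def by blast
qed

text \<open>Subgradients are monotone: evaluate each subgradient inequality at the other point and
  add. The points \<open>a\<close> and \<open>b\<close> are characterized by their subgradients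
  instead of being written as \<open>prox\<close>, so that the lemma yields the Lipschitz bound as
  well as uniqueness.\<close>

lemma prox_points_nonexpansive:
  assumes \<gamma>: "0 < \<gamma>"
    and a: "g a = ereal s" "\<And>y. g y \<ge> ereal (s + (1 / \<gamma>) * ((u - a) \<bullet> (y - a)))"
    and b: "g b = ereal r" "\<And>y. g y \<ge> ereal (r + (1 / \<gamma>) * ((v - b) \<bullet> (y - b)))"
  shows "norm (a - b) \<le> norm (u - v)"
proof -
  have "(1 / \<gamma>) * ((u - a) \<bullet> (b - a)) + (1 / \<gamma>) * ((v - b) \<bullet> (a - b)) \<le> 0"
    using a(2)[of b] b(2)[of a] by (simp add: a(1) b(1))
  then have "(1 / \<gamma>) * ((u - a) \<bullet> (b - a) + (v - b) \<bullet> (a - b)) \<le> 0"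
    by (simp add: distrib_left)
  then have "(u - a) \<bullet> (b - a) + (v - b) \<bullet> (a - b) \<le> 0"
    using \<gamma> by (simp add: divide_le_0_iff)
  then have "(norm (a - b))\<^sup>2 \<le> (u - v) \<bullet> (a - b)"
    unfolding power2_norm_eq_inner by (simp add: algebra_simps inner_diff_left inner_diff_right)
  also have "\<dots> \<le> norm (u - v) * norm (a - b)" by (rule norm_cauchy_schwarz)
  finally show ?thesis
    by (cases "a = b") (auto simp: power2_eq_square)
qed

lemma prox_nonexpansive:
  assumes "0 < \<gamma>"
  shows "norm (prox \<gamma> g u - prox \<gamma> g v) \<le> norm (u - v)"
  by (rule prox_subgradient[OF assms, of u], rule prox_subgradient[OF assms, of v],
      rule prox_points_nonexpansive[OF assms])

lemma prox_eqI:
  assumes \<gamma>: "0 < \<gamma>"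
    and a: "g a = ereal s" "\<And>y. g y \<ge> ereal (s + (1 / \<gamma>) * ((u - a) \<bullet> (y - a)))"
  shows "prox \<gamma> g u = a"
proof -
  have "norm (prox \<gamma> g u - a) \<le> norm (u - u)"
    by (rule prox_subgradient[OF \<gamma>, of u], rule prox_points_nonexpansive[OF \<gamma>]) (use a in auto)
  then show ?thesis by simp
qed

end

lemma prox_regularization_at_composite_minimizer:
  assumes g: "convex_fun g" "proper_fun g" "lsc_fun g"
    and h: "GDERIV h p :> D"
    and min: "is_arg_min (\<lambda>v. ereal (h v) + g v) (\<lambda>_. True) p"
  obtains s where "prox_regularization g p (- D) s"
proof -
  have le: "ereal (h p) + g p \<le> ereal (h y) + g y" for y
    using min by (auto simp: is_arg_min_def not_less)
  have no_minf: "g y \<noteq> -\<infinity>" for y using g(2) by (simp add: proper_fun_def)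
  obtain y where "g y \<noteq> \<infinity>" using g(2) by (auto simp: proper_fun_def)
  then obtain s where s: "g p = ereal s"
    using le[of y] no_minf[of p] no_minf[of y] by (cases "g p"; cases "g y") auto
  show ?thesis
    using that[of s] g s convex_subgradient_at_composite_minimizer[OF h g(1) no_minf s le]
    by (simp add: prox_regularization_def)
qed

text \<open>The optimality condition of \<open>p\<close> for \<open>f + g\<close>, that \<open>-
  D\<close> is a subgradient of \<open>g\<close> at \<open>p\<close>, is also the one of the
  proximal problem at \<open>p - \<gamma> D\<close>.\<close>

lemma minimizer_is_forward_backward_fixed_point:
  assumes "0 < \<gamma>" "prox_regularization g p (- D) s"
  shows "prox \<gamma> g (p - \<gamma> *\<^sub>R D) = p"
proof -
  interpret prox_regularization g p "- D" s by fact
  show ?thesis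
    by (rule prox_eqI[OF assms(1) g_x0]) (use assms(1) minorant in simp)
qed

section \<open>Spectral theorem and matrix square roots\<close>

text \<open>A maximizer \<open>v\<close> of \<open>x \<bullet> T x\<close> on the unit sphere of
  \<open>V\<close> is an eigenvector. With \<open>c\<close> the maximum, the form \<open>q x = c
  (x \<bullet> x) - x \<bullet> T x\<close> is nonnegative on \<open>V\<close> and vanishes at
  \<open>v\<close>. Moving from \<open>v\<close> in the direction of the residual \<open>w = T v -
  c v\<close> would change it by \<open>- 2 t (w \<bullet> w) + O(t\<^sup>2)\<close>, so the
  residual is zero.\<close>

lemma self_adjoint_eigenvector_in_invariant_subspace:
  fixes T :: "'a::euclidean_space \<Rightarrow> 'a"
  assumes T: "linear T" and sym: "\<And>x y. T x \<bullet> y = x \<bullet> T y"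
    and V: "subspace V" "T ` V \<subseteq> V" "V \<noteq> {0}"
  obtains v c where "v \<in> V" "norm v = 1" "T v = c *\<^sub>R v"
proof -
  let ?S = "sphere 0 1 \<inter> V"
  obtain u where u: "u \<in> V" "u \<noteq> 0" using V subspace_0[OF V(1)] by blast
  then have "(1 / norm u) *\<^sub>R u \<in> ?S" using V(1) by (simp add: subspace_scale)
  then have ne: "?S \<noteq> {}" by blast
  have cpt: "compact ?S"
    using closed_subspace[OF V(1)] by (intro compact_Int_closed) simp_all
  have "continuous_on ?S (\<lambda>x. x \<bullet> T x)"
    using linear_continuous_on[of T] T
    by (intro continuous_intros) (simp add: linear_conv_bounded_linear)
  then obtain v where v: "v \<in> ?S" "\<And>x. x \<in> ?S \<Longrightarrow> x \<bullet> T x \<le> v \<bullet> T v"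
    using continuous_attains_sup[OF cpt ne] by blast
  define c where "c = v \<bullet> T v"
  define q where "q x = c * (x \<bullet> x) - x \<bullet> T x" for x
  have q_nonneg: "0 \<le> q x" if x: "x \<in> V" for x
  proof (cases "x = 0")
    case False
    let ?x = "(1 / norm x) *\<^sub>R x"
    have "?x \<bullet> T ?x \<le> c"
      using v(2)[of ?x] x False V(1) by (simp add: c_def subspace_scale)
    then have "(x \<bullet> T x) / (norm x)\<^sup>2 \<le> c"
      using T by (simp add: linear_scale power2_eq_square)
    then show ?thesis using False
      by (simp add: q_def power2_norm_eq_inner[symmetric] pos_divide_le_eq)
  qed (use T in \<open>simp add: q_def linear_0\<close>)
  have nv: "v \<bullet> v = 1" "v \<in> V"
    using v(1) by (auto simp: power2_norm_eq_inner[symmetric])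
  define w where "w = T v - c *\<^sub>R v"
  have w: "w \<in> V"
    using nv V by (auto simp: w_def intro!: subspace_diff subspace_scale)
  have ww: "w \<bullet> T v - c * (w \<bullet> v) = w \<bullet> w"
    by (simp add: w_def inner_diff_right)
  have q_line: "q (v + t *\<^sub>R w) = - 2 * t * (w \<bullet> w) + t\<^sup>2 * q w" for t
  proof -
    have "q (v + t *\<^sub>R w) = q v - 2 * t * (w \<bullet> T v - c * (w \<bullet> v)) + t\<^sup>2 * q w"
      using T sym[of w v, symmetric]
      by (simp add: q_def linear_add linear_scale inner_add_left inner_add_right inner_commute
          power2_eq_square algebra_simps)
    moreover have "q v = 0" using nv by (simp add: q_def c_def)
    ultimately show ?thesis by (simp add: ww)
  qed
  have "w = 0"
  proof (rule ccontr)
    assume "w \<noteq> 0"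
    then have pos: "0 < w \<bullet> w" by simp
    \<comment> \<open>Small enough for the quadratic term to stay within half of the linear one; the \<open>+ 1\<close> covers \<open>q w = 0\<close>.\<close>
    define t where "t = (w \<bullet> w) / (q w + 1)"
    have qw: "0 \<le> q w" by (rule q_nonneg[OF w])
    have t: "0 < t" using pos qw by (simp add: t_def)
    have "t * q w \<le> w \<bullet> w"
      using pos qw by (simp add: t_def field_simps)
    then have "- 2 * (w \<bullet> w) + t * q w < 0" using pos by linarith
    then have "t * (- 2 * (w \<bullet> w) + t * q w) < 0"
      using t by (rule mult_pos_neg[rotated])
    moreover have "0 \<le> t * (- 2 * (w \<bullet> w) + t * q w)"
      using q_nonneg[of "v + t *\<^sub>R w"] nv(2) w V(1) q_line[of t]
      by (simp add: subspace_add subspace_scale power2_eq_square algebra_simps)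
    ultimately show False by simp
  qed
  then show ?thesis using that[of v c] v(1) by (simp add: w_def)
qed

text \<open>The eigenvalue of a unit eigenvector \<open>b\<close> is recovered as \<open>b
  \<bullet> T b\<close>, which avoids carrying a separate function of eigenvalues. The set
  \<open>V\<close> is a parameter so that the spectral theorem can be proved by induction over
  invariant subspaces.\<close>

definition orthonormal_eigenbasis :: "('a::real_inner \<Rightarrow> 'a) \<Rightarrow> 'a set \<Rightarrow> 'a set \<Rightarrow> bool" where
  "orthonormal_eigenbasis T V B \<longleftrightarrow> finite B \<and> B \<subseteq> V \<and> pairwise orthogonal B \<and>
     (\<forall>b\<in>B. norm b = 1 \<and> T b = (b \<bullet> T b) *\<^sub>R b) \<and> V \<subseteq> span B"

text \<open>Split off one eigenvector; self-adjointness keeps its orthogonal complement invariant,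
  and the dimension drops.\<close>

lemma orthonormal_eigenbasis_exists_on_subspace:
  fixes T :: "'a::euclidean_space \<Rightarrow> 'a"
  assumes T: "linear T" and sym: "\<And>x y. T x \<bullet> y = x \<bullet> T y"
    and "subspace V" "T ` V \<subseteq> V"
  shows "\<exists>B. orthonormal_eigenbasis T V B"
  using assms(3,4)
proof (induction "dim V" arbitrary: V rule: less_induct)
  case less
  show ?case
  proof (cases "V = {0}")
    case True
    then have "orthonormal_eigenbasis T V {}" by (simp add: orthonormal_eigenbasis_def)
    then show ?thesis ..
  next
    case False
    obtain v c where v: "v \<in> V" "norm v = 1" "T v = c *\<^sub>R v"
      using self_adjoint_eigenvector_in_invariant_subspace[OF T sym less.prems False] by blast
    have vv: "v \<bullet> v = 1" using v(2) by (simp add: power2_norm_eq_inner[symmetric])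
    define W where "W = {x \<in> V. v \<bullet> x = 0}"
    have W: "subspace W"
      using less.prems(1) unfolding W_def subspace_def by (auto simp: inner_add_right)
    have "T ` W \<subseteq> W"
      using less.prems(2) v(3) by (auto simp: W_def sym[symmetric])
    moreover have "dim W < dim V"
    proof (rule dim_psubset)
      have "v \<notin> W" using vv by (simp add: W_def)
      moreover have "W \<subseteq> V" by (auto simp: W_def)
      ultimately have "W \<subset> V" using v(1) by blast
      then show "span W \<subset> span V"
        using W less.prems(1) by (metis span_eq_iff)
    qed
    ultimately obtain B where "orthonormal_eigenbasis T W B"
      using less.hyps W by blast
    then have B: "finite B" "B \<subseteq> W" "pairwise orthogonal B" "W \<subseteq> span B"
      "\<And>b. b \<in> B \<Longrightarrow> norm b = 1 \<and> T b = (b \<bullet> T b) *\<^sub>R b"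
      by (auto simp: orthonormal_eigenbasis_def)
    have "x \<in> span (insert v B)" if x: "x \<in> V" for x
    proof -
      have "x - (v \<bullet> x) *\<^sub>R v \<in> W"
        using x v(1) vv less.prems(1)
        by (auto simp: W_def inner_diff_right intro!: subspace_diff subspace_scale)
      then have "x - (v \<bullet> x) *\<^sub>R v \<in> span B" using B(4) by blast
      then show ?thesis by (metis span_breakdown_eq)
    qed
    moreover have "pairwise orthogonal (insert v B)"
      using B(2,3) by (auto simp: pairwise_insert orthogonal_def W_def inner_commute)
    ultimately have "orthonormal_eigenbasis T V (insert v B)"
      using B v vv by (auto simp: orthonormal_eigenbasis_def W_def)
    then show ?thesis ..
  qed
qed

lemma orthonormal_eigenbasis_expand:
  fixes T :: "'a::euclidean_space \<Rightarrow> 'a"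
  assumes "orthonormal_eigenbasis T UNIV B"
  shows "x = (\<Sum>b\<in>B. (b \<bullet> x) *\<^sub>R b)"
proof -
  have "x \<in> span B" using assms by (auto simp: orthonormal_eigenbasis_def)
  then have "(\<Sum>b\<in>B. (x \<bullet> b) *\<^sub>R b) = x"
    using assms by (intro orthonormal_basis_expand) (auto simp: orthonormal_eigenbasis_def)
  then show ?thesis by (simp add: inner_commute[of x])
qed

lemma inner_eigenbasis:
  fixes T :: "'a::euclidean_space \<Rightarrow> 'a"
  assumes B: "orthonormal_eigenbasis T UNIV B"
  shows "x \<bullet> y = (\<Sum>b\<in>B. (b \<bullet> x) * (b \<bullet> y))"
  by (subst orthonormal_eigenbasis_expand[OF B, of x]) (simp add: inner_sum_left)

lemma symmetric_matrix_inner: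
  fixes A :: "real^'n^'n"
  assumes "transpose A = A"
  shows "(A *v x) \<bullet> y = x \<bullet> (A *v y)"
  by (metis assms dot_lmul_matrix transpose_matrix_vector)

lemma symmetric_matrix_eigenbasis:
  fixes A :: "real^'n^'n"
  assumes "transpose A = A"
  obtains B where "orthonormal_eigenbasis ((*v) A) UNIV B"
  using orthonormal_eigenbasis_exists_on_subspace[of "(*v) A" UNIV]
    symmetric_matrix_inner[OF assms] by auto

text \<open>An eigenvector for \<open>c\<close> has a nonzero coefficient at some basis vector
  \<open>b\<close>; comparing the two ways of computing \<open>(A b) \<bullet> v\<close> shows
  that \<open>c\<close> is the eigenvalue of \<open>b\<close>. In particular there are finitely
  many eigenvalues, so \<open>lambda_min\<close> and \<open>lambda_max\<close> are
  attained.\<close>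

lemma eigenvalues_eq_rayleigh_on_eigenbasis:
  fixes A :: "real^'n^'n"
  assumes A: "transpose A = A" and B: "orthonormal_eigenbasis ((*v) A) UNIV B"
  shows "eigenvalues A = (\<lambda>b. b \<bullet> (A *v b)) ` B"
proof (intro equalityI subsetI)
  fix c assume "c \<in> eigenvalues A"
  then obtain v where v: "v \<noteq> 0" "A *v v = c *\<^sub>R v" by (auto simp: eigenvalues_def)
  have "\<exists>b\<in>B. b \<bullet> v \<noteq> 0"
    using v(1) orthonormal_eigenbasis_expand[OF B, of v] by (metis (mono_tags, lifting) scale_eq_0_iff sum.neutral)
  then obtain b where b: "b \<in> B" "b \<bullet> v \<noteq> 0" by blast
  have "A *v b = (b \<bullet> (A *v b)) *\<^sub>R b" using B b(1) by (auto simp: orthonormal_eigenbasis_def)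
  then have "(b \<bullet> (A *v b)) * (b \<bullet> v) = (A *v b) \<bullet> v" by (metis inner_scaleR_left)
  also have "\<dots> = c * (b \<bullet> v)"
    by (simp add: symmetric_matrix_inner[OF A] v(2))
  finally show "c \<in> (\<lambda>b. b \<bullet> (A *v b)) ` B" using b by auto
next
  fix c assume "c \<in> (\<lambda>b. b \<bullet> (A *v b)) ` B"
  then obtain b where b: "b \<in> B" "c = b \<bullet> (A *v b)" by blast
  then have "A *v b = c *\<^sub>R b" "norm b = 1" using B by (auto simp: orthonormal_eigenbasis_def)
  then show "c \<in> eigenvalues A" unfolding eigenvalues_def by (auto intro!: exI[of _ b])
qed

lemma quadratic_form_eigenbasis:
  fixes A :: "real^'n^'n"
  assumes A: "transpose A = A" and B: "orthonormal_eigenbasis ((*v) A) UNIV B"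
  shows "x \<bullet> (A *v x) = (\<Sum>b\<in>B. (b \<bullet> (A *v b)) * (b \<bullet> x)\<^sup>2)"
proof -
  have "b \<bullet> (A *v x) = (b \<bullet> (A *v b)) * (b \<bullet> x)" if "b \<in> B" for b
  proof -
    have "A *v b = (b \<bullet> (A *v b)) *\<^sub>R b" using B that by (auto simp: orthonormal_eigenbasis_def)
    then show ?thesis by (metis inner_scaleR_left symmetric_matrix_inner[OF A])
  qed
  then show ?thesis
    by (subst inner_eigenbasis[OF B]) (auto intro!: sum.cong simp: power2_eq_square)
qed

lemma rayleigh_bounds:
  fixes A :: "real^'n^'n"
  assumes A: "transpose A = A"
  shows "lambda_min A * (norm x)\<^sup>2 \<le> x \<bullet> (A *v x)"
    and "x \<bullet> (A *v x) \<le> lambda_max A * (norm x)\<^sup>2"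
    and "finite (eigenvalues A)" and "eigenvalues A \<noteq> {}"
proof -
  obtain B where B: "orthonormal_eigenbasis ((*v) A) UNIV B"
    using symmetric_matrix_eigenbasis[OF A] .
  note ev = eigenvalues_eq_rayleigh_on_eigenbasis[OF A B]
  have fin: "finite B" using B by (simp add: orthonormal_eigenbasis_def)
  have "B \<noteq> {}"
  proof
    assume "B = {}"
    then have "(1 :: real^'n) = 0" using orthonormal_eigenbasis_expand[OF B, of 1] by simp
    then show False by simp
  qed
  then show "finite (eigenvalues A)" "eigenvalues A \<noteq> {}" using fin by (auto simp: ev)
  then have bd: "lambda_min A \<le> b \<bullet> (A *v b)" "b \<bullet> (A *v b) \<le> lambda_max A" if "b \<in> B" for b
    using that by (auto simp: ev lambda_min_def lambda_max_def)
  have nx: "(norm x)\<^sup>2 = (\<Sum>b\<in>B. (b \<bullet> x)\<^sup>2)"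
    unfolding power2_norm_eq_inner by (subst inner_eigenbasis[OF B]) (simp add: power2_eq_square)
  show "lambda_min A * (norm x)\<^sup>2 \<le> x \<bullet> (A *v x)" "x \<bullet> (A *v x) \<le> lambda_max A * (norm x)\<^sup>2"
    unfolding quadratic_form_eigenbasis[OF A B, of x] nx sum_distrib_left
    by (auto intro!: sum_mono mult_right_mono bd)
qed

text \<open>Keep the eigenbasis and replace each eigenvalue by its square root.\<close>

lemma positive_definite_sqrt_exists:
  fixes A :: "real^'n^'n"
  assumes A: "positive_definite A"
  shows "\<exists>R. positive_definite R \<and> R ** R = A"
proof -
  have sym: "transpose A = A" using A by (simp add: positive_definite_def)
  obtain B where B: "orthonormal_eigenbasis ((*v) A) UNIV B"
    using symmetric_matrix_eigenbasis[OF sym] .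
  have fin: "finite B" using B by (simp add: orthonormal_eigenbasis_def)
  define s where "s b = sqrt (b \<bullet> (A *v b))" for b
  have s_pos: "0 < s b" if "b \<in> B" for b
  proof -
    have "b \<noteq> 0" using B that by (auto simp: orthonormal_eigenbasis_def)
    then show ?thesis using A by (simp add: s_def positive_definite_def)
  qed
  define h where "h x = (\<Sum>b\<in>B. (s b * (b \<bullet> x)) *\<^sub>R b)" for x :: "real^'n"
  have "linear h"
    unfolding h_def
    by (rule linearI) (simp_all add: inner_add_right algebra_simps sum.distrib scaleR_sum_right)
  then have h: "matrix h *v x = h x" for x by simp
  have ortho: "b \<bullet> h x = s b * (b \<bullet> x)" if b: "b \<in> B" for b x
  proof -
    have "b \<bullet> h x = (\<Sum>b'\<in>B. (s b' * (b' \<bullet> x)) * (b \<bullet> b'))"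
      by (simp add: h_def inner_sum_right)
    also have "\<dots> = (\<Sum>b'\<in>B. if b' = b then s b * (b \<bullet> x) else 0)"
    proof (rule sum.cong[OF refl])
      fix b' assume "b' \<in> B"
      then show "s b' * (b' \<bullet> x) * (b \<bullet> b') = (if b' = b then s b * (b \<bullet> x) else 0)"
        using B b by (auto simp: orthonormal_eigenbasis_def pairwise_def orthogonal_def norm_eq_1)
    qed
    finally show ?thesis using fin b by simp
  qed
  have form: "x \<bullet> h y = (\<Sum>b\<in>B. s b * (b \<bullet> x) * (b \<bullet> y))" for x y
    by (subst inner_eigenbasis[OF B]) (auto intro!: sum.cong simp: ortho)
  have "matrix h ** matrix h = A"
  proof (subst matrix_eq, intro allI)
    fix x
    have "(matrix h ** matrix h) *v x = h (h x)"
      by (simp add: matrix_vector_mul_assoc[symmetric] h)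
    also have "\<dots> = (\<Sum>b\<in>B. (b \<bullet> x) *\<^sub>R (A *v b))"
      unfolding h_def[of "h x"]
    proof (rule sum.cong[OF refl])
      fix b assume b: "b \<in> B"
      have "A *v b = (s b * s b) *\<^sub>R b"
        using B b s_pos[OF b] unfolding s_def by (auto simp: orthonormal_eigenbasis_def)
      then show "(s b * (b \<bullet> h x)) *\<^sub>R b = (b \<bullet> x) *\<^sub>R (A *v b)"
        by (simp add: ortho[OF b] mult_ac)
    qed
    also have "\<dots> = A *v (\<Sum>b\<in>B. (b \<bullet> x) *\<^sub>R b)"
      by (simp add: linear_sum[OF matrix_vector_mul_linear] matrix_vector_mult_scaleR)
    also have "\<dots> = A *v x" by (simp flip: orthonormal_eigenbasis_expand[OF B, of x])
    finally show "(matrix h ** matrix h) *v x = A *v x" .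
  qed
  moreover have "transpose (matrix h) = matrix h"
  proof -
    have "x \<bullet> (transpose (matrix h) *v y) = x \<bullet> (matrix h *v y)" for x y
    proof -
      have "x \<bullet> (transpose (matrix h) *v y) = y \<bullet> h x"
        using dot_lmul_matrix[of y "matrix h" x] by (simp add: h inner_commute)
      also have "\<dots> = x \<bullet> h y" by (simp add: form mult_ac)
      finally show ?thesis by (simp add: h)
    qed
    then show ?thesis by (subst matrix_eq) (metis vector_eq_rdot inner_commute)
  qed
  moreover have "0 < x \<bullet> (matrix h *v x)" if x: "x \<noteq> 0" for x
  proof -
    obtain b where b: "b \<in> B" "b \<bullet> x \<noteq> 0"
      using x orthonormal_eigenbasis_expand[OF B, of x] by (metis (mono_tags, lifting) scale_eq_0_iff sum.neutral)
    have "0 < (\<Sum>b\<in>B. s b * (b \<bullet> x)\<^sup>2)"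
    proof (rule sum_pos2[OF fin b(1)])
      show "0 < s b * (b \<bullet> x)\<^sup>2" using b s_pos by simp
      show "0 \<le> s b * (b \<bullet> x)\<^sup>2" if "b \<in> B" for b
        using s_pos[OF that] by simp
    qed
    then show ?thesis by (simp add: h form power2_eq_square mult.assoc)
  qed
  ultimately show ?thesis unfolding positive_definite_def by blast
qed

text \<open>If \<open>R b = s b\<close> then \<open>(R' + s) (R' - s) b = R'\<^sup>2 b - s\<^sup>2
  b = 0\<close>, and \<open>R' + s\<close> is injective because \<open>R'\<close> is positive
  definite and \<open>s > 0\<close>. So \<open>R'\<close> agrees with \<open>R\<close> on an
  eigenbasis of \<open>R\<close>.\<close>

lemma positive_definite_sqrt_unique:
  fixes R R' :: "real^'n^'n"
  assumes R: "positive_definite R" and R': "positive_definite R'" and eq: "R ** R = R' ** R'"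
  shows "R' = R"
proof -
  have sym: "transpose R = R" using R by (simp add: positive_definite_def)
  obtain B where B: "orthonormal_eigenbasis ((*v) R) UNIV B"
    using symmetric_matrix_eigenbasis[OF sym] .
  have agree: "R' *v b = R *v b" if b: "b \<in> B" for b
  proof -
    define s where "s = b \<bullet> (R *v b)"
    have Rb: "R *v b = s *\<^sub>R b" and "norm b = 1"
      using B b by (auto simp: orthonormal_eigenbasis_def s_def)
    then have "b \<noteq> 0" by auto
    then have s: "0 < s" using R by (simp add: s_def positive_definite_def)
    define d where "d = R' *v b - s *\<^sub>R b"
    have "R' *v (R' *v b) = R *v (R *v b)" by (simp add: eq matrix_vector_mul_assoc)
    then have "R' *v d = - s *\<^sub>R d"
      by (simp add: d_def Rb matrix_vector_mult_diff_distrib matrix_vector_mult_scaleR algebra_simps)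
    then have "d \<bullet> (R' *v d) = - s * (d \<bullet> d)" by simp
    then have "d \<bullet> (R' *v d) \<le> 0" using s by simp
    then have "d = 0" using R' by (meson not_less positive_definite_def)
    then show ?thesis by (simp add: d_def Rb)
  qed
  show ?thesis
  proof (subst matrix_eq, intro allI)
    fix x
    have "A *v x = (\<Sum>b\<in>B. (b \<bullet> x) *\<^sub>R (A *v b))" for A :: "real^'n^'n"
      by (subst orthonormal_eigenbasis_expand[OF B, of x])
        (simp add: linear_sum[OF matrix_vector_mul_linear] matrix_vector_mult_scaleR)
    then show "R' *v x = R *v x" by (simp add: agree)
  qed
qed

lemma matrix_sqrt:
  assumes "positive_definite A"
  shows "positive_definite (matrix_sqrt A)" "matrix_sqrt A ** matrix_sqrt A = A"
proof -
  have "\<exists>!R. positive_definite R \<and> R ** R = A"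
    using positive_definite_sqrt_exists[OF assms] positive_definite_sqrt_unique by blast
  from theI'[OF this] show "positive_definite (matrix_sqrt A)" "matrix_sqrt A ** matrix_sqrt A = A"
    unfolding matrix_sqrt_def by auto
qed

text \<open>This is why the algorithm is preconditioned by the inverse square root: for the mean
  projection \<open>A\<close> the right-hand side is the expected squared length of the projection of
  \<open>x\<close>.\<close>

lemma norm_matrix_sqrt_squared:
  assumes "positive_definite A"
  shows "(norm (matrix_sqrt A *v x))\<^sup>2 = x \<bullet> (A *v x)"
proof -
  have sym: "transpose (matrix_sqrt A) = matrix_sqrt A"
    using matrix_sqrt(1)[OF assms] by (simp add: positive_definite_def)
  have "x \<bullet> (A *v x) = x \<bullet> (matrix_sqrt A *v (matrix_sqrt A *v x))"
    by (simp add: matrix_vector_mul_assoc matrix_sqrt(2)[OF assms])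
  then show ?thesis
    by (simp add: power2_norm_eq_inner symmetric_matrix_inner[OF sym])
qed

lemma positive_definite_invertible:
  fixes A :: "real^'n^'n"
  assumes "positive_definite A"
  shows "invertible A"
proof -
  have "x = 0" if "A *v x = 0" for x
    using assms that unfolding positive_definite_def by force
  then show ?thesis
    using invertible_left_inverse matrix_left_invertible_ker by blast
qed

lemma matrix_inv_two_sided:
  fixes A :: "real^'n^'n"
  assumes "invertible A"
  shows "A ** matrix_inv A = mat 1" "matrix_inv A ** A = mat 1"
  using someI_ex[OF assms[unfolded invertible_def]] unfolding matrix_inv_def by auto

lemma matrix_vector_mult_matrix_inv:
  fixes A :: "real^'n^'n"
  assumes "invertible A"
  shows "A *v (matrix_inv A *v x) = x"
  by (simp add: matrix_vector_mul_assoc matrix_inv_two_sided[OF assms])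

lemma matrix_inv_matrix_inv:
  fixes A :: "real^'n^'n"
  assumes A: "invertible A"
  shows "matrix_inv (matrix_inv A) = A"
proof -
  have "invertible (matrix_inv A)"
    using matrix_inv_two_sided[OF A] unfolding invertible_def by blast
  then have "matrix_inv (matrix_inv A) = (A ** matrix_inv A) ** matrix_inv (matrix_inv A)"
    using matrix_inv_two_sided[OF A] by simp
  then show ?thesis
    using matrix_inv_two_sided(1)[OF \<open>invertible (matrix_inv A)\<close>]
    by (simp add: matrix_mul_assoc[symmetric])
qed

section \<open>Orthogonal projections and independent expectations\<close>

lemma inner_proj_matrix_idem:
  assumes "subspace F"
  shows "(proj_matrix F *v v) \<bullet> w = (proj_matrix F *v v) \<bullet> (proj_matrix F *v w)"
proof -
  have "(proj_matrix F *v v) \<bullet> (w - proj_matrix F *v w) = 0"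
    using proj_matrix(1)[OF assms, of v] proj_matrix(2)[OF assms, of w]
    by (auto simp: orthogonal_comp_def orthogonal_def)
  then show ?thesis by (simp add: inner_diff_right)
qed

lemma inner_proj_matrix_commute:
  assumes "subspace F"
  shows "(proj_matrix F *v v) \<bullet> w = v \<bullet> (proj_matrix F *v w)"
  using inner_proj_matrix_idem[OF assms, of v w] inner_proj_matrix_idem[OF assms, of w v]
  by (simp add: inner_commute)

lemma inner_proj_matrix_self:
  assumes "subspace F"
  shows "v \<bullet> (proj_matrix F *v v) = (norm (proj_matrix F *v v))\<^sup>2"
  using inner_proj_matrix_idem[OF assms, of v v]
  by (simp add: power2_norm_eq_inner inner_commute)

lemma norm_proj_matrix_le:
  assumes "subspace F"
  shows "norm (proj_matrix F *v v) \<le> norm v"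
proof -
  have "norm (proj_matrix F *v v) * norm (proj_matrix F *v v) \<le> norm v * norm (proj_matrix F *v v)"
    using norm_cauchy_schwarz[of v "proj_matrix F *v v"] inner_proj_matrix_self[OF assms, of v]
    by (simp add: power2_eq_square)
  then show ?thesis
    by (cases "proj_matrix F *v v = 0") auto
qed

text \<open>Pythagoras: the first summand lies in \<open>F\<close> and the second in its
  orthogonal complement.\<close>

lemma norm_proj_matrix_combination:
  assumes "subspace F"
  shows "(norm (proj_matrix F *v a + (b - proj_matrix F *v b)))\<^sup>2
    = a \<bullet> (proj_matrix F *v a) + (norm b)\<^sup>2 - b \<bullet> (proj_matrix F *v b)"
proof -
  let ?P = "\<lambda>v. proj_matrix F *v v"
  have "?P a \<bullet> b = ?P a \<bullet> ?P b" "?P b \<bullet> b = ?P b \<bullet> ?P b" "?P a \<bullet> a = ?P a \<bullet> ?P a"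
    using inner_proj_matrix_idem[OF assms] by auto
  then show ?thesis
    by (simp add: power2_norm_eq_inner inner_add_left inner_add_right inner_diff_left
        inner_diff_right inner_commute)
qed

lemma proj_matrix_eq_0_iff:
  assumes "subspace F"
  shows "proj_matrix F *v v = 0 \<longleftrightarrow> v \<in> F\<^sup>\<bottom>"
proof
  assume "proj_matrix F *v v = 0"
  then show "v \<in> F\<^sup>\<bottom>" using proj_matrix(2)[OF assms, of v] by simp
next
  assume "v \<in> F\<^sup>\<bottom>"
  then have "(proj_matrix F *v v) \<bullet> v = 0"
    using proj_matrix(1)[OF assms, of v] by (auto simp: orthogonal_comp_def orthogonal_def)
  then show "proj_matrix F *v v = 0"
    using inner_proj_matrix_idem[OF assms, of v v] by simp
qed

text \<open>A crude bound, needed only for the integrability of random projections; each entry has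
  absolute value at most one.\<close>

lemma norm_proj_matrix_le_card:
  fixes F :: "(real^'n) set"
  assumes "subspace F"
  shows "norm (proj_matrix F) \<le> real (CARD('n) * CARD('n))"
proof -
  have entry: "\<bar>proj_matrix F $ i $ j\<bar> \<le> 1" for i j
  proof -
    have "proj_matrix F $ i $ j = (proj_matrix F *v axis j 1) $ i"
      by (simp add: matrix_vector_mult_basis column_def)
    also have "\<bar>\<dots>\<bar> \<le> norm (proj_matrix F *v axis j 1)" by (rule component_le_norm_cart)
    also have "\<dots> \<le> 1" using norm_proj_matrix_le[OF assms, of "axis j 1"] by simp
    finally show ?thesis .
  qed
  have "norm (proj_matrix F) \<le> (\<Sum>i\<in>UNIV. norm (proj_matrix F $ i))"
    by (simp add: norm_vec_def L2_set_le_sum)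
  also have "\<dots> \<le> (\<Sum>i\<in>(UNIV::'n set). \<Sum>j\<in>(UNIV::'n set). 1)"
    by (intro sum_mono order_trans[OF norm_le_l1_cart] entry)
  finally show ?thesis by simp
qed

lemma bounded_linear_matrix_form:
  fixes v :: "real^'m" and w :: "real^'n"
  shows "bounded_linear (\<lambda>A. v \<bullet> (A *v w))"
proof -
  have "linear (\<lambda>A. v \<bullet> (A *v w))"
    by (rule linearI)
      (simp_all add: matrix_vector_mult_add_rdistrib inner_add_right flip: scaleR_matrix_vector_assoc)
  then show ?thesis by (simp add: linear_conv_bounded_linear)
qed

lemma borel_measurable_matrix_vector_mult:
  fixes A :: "'b \<Rightarrow> real^'n^'m" and v :: "'b \<Rightarrow> real^'n"
  assumes "A \<in> borel_measurable N" "v \<in> borel_measurable N"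
  shows "(\<lambda>\<omega>. A \<omega> *v v \<omega>) \<in> borel_measurable N"
proof (rule borel_measurable_continuous_Pair[OF assms])
  show "continuous_on UNIV (\<lambda>x. fst x *v snd x :: real^'m)"
    unfolding matrix_vector_mult_def by (intro continuous_intros)
qed

text \<open>Conditioning on \<open>Y\<close> replaces \<open>X\<close> by its mean. Written out in
  coordinates, this is multiplicativity of the expectation for the independent pairs
  \<open>(Y\<^sub>i Y\<^sub>j, X\<^sub>i\<^sub>j)\<close>. Independence is assumed for these real
  variables because \<open>indep_var\<close> relates variables of one common type.\<close>

lemma (in prob_space) expectation_quadratic_form_indep:
  fixes X :: "'a \<Rightarrow> real^'n^'n" and Y :: "'a \<Rightarrow> real^'n"
  assumes Y: "Y \<in> borel_measurable M"
    and ind: "\<And>i j. indep_var borel (\<lambda>\<omega>. Y \<omega> $ i * Y \<omega> $ j) borel (\<lambda>\<omega>. X \<omega> $ i $ j)"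
    and bd: "\<And>\<omega>. \<omega> \<in> space M \<Longrightarrow> norm (Y \<omega>) \<le> K"
    and X: "integrable M X"
  shows "integrable M (\<lambda>\<omega>. Y \<omega> \<bullet> (X \<omega> *v Y \<omega>))"
    and "expectation (\<lambda>\<omega>. Y \<omega> \<bullet> (X \<omega> *v Y \<omega>)) = expectation (\<lambda>\<omega>. Y \<omega> \<bullet> (expectation X *v Y \<omega>))"
proof -
  have form: "v \<bullet> (A *v v) = (\<Sum>i\<in>UNIV. \<Sum>j\<in>UNIV. (v $ i * v $ j) * A $ i $ j)"
    for v :: "real^'n" and A :: "real^'n^'n"
    by (simp add: inner_vec_def matrix_vector_mult_def sum_distrib_left mult_ac)
  have YY: "integrable M (\<lambda>\<omega>. Y \<omega> $ i * Y \<omega> $ j)" for i j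
  proof (rule integrable_const_bound[where B = "K * K"])
    show "AE \<omega> in M. norm (Y \<omega> $ i * Y \<omega> $ j) \<le> K * K"
    proof (rule AE_I2)
      fix \<omega> assume "\<omega> \<in> space M"
      then have "\<bar>Y \<omega> $ l\<bar> \<le> K" for l
        using component_le_norm_cart[of "Y \<omega>" l] bd by (meson order_trans)
      then show "norm (Y \<omega> $ i * Y \<omega> $ j) \<le> K * K"
        unfolding real_norm_def abs_mult
        by (meson abs_ge_zero mult_mono order_trans)
    qed
    have "(\<lambda>v::real^'n. v $ i * v $ j) \<in> borel_measurable borel"
      by (intro borel_measurable_continuous_onI continuous_intros)
    from measurable_compose[OF Y this] show "(\<lambda>\<omega>. Y \<omega> $ i * Y \<omega> $ j) \<in> borel_measurable M" .
  qed
  have lin: "bounded_linear (\<lambda>A::real^'n^'n. A $ i $ j)" for i j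
    using bounded_linear_compose[OF bounded_linear_vec_nth[of j] bounded_linear_vec_nth[of i]] .
  have Xij: "integrable M (\<lambda>\<omega>. X \<omega> $ i $ j)"
    "expectation (\<lambda>\<omega>. X \<omega> $ i $ j) = expectation X $ i $ j" for i j
    using integrable_bounded_linear[OF lin X] integral_bounded_linear[OF lin X] by auto
  note prod = indep_var_integrable[OF ind YY Xij(1)] indep_var_lebesgue_integral[OF ind YY Xij(1)]
  show "integrable M (\<lambda>\<omega>. Y \<omega> \<bullet> (X \<omega> *v Y \<omega>))"
    unfolding form by (intro Bochner_Integration.integrable_sum prod)
  show "expectation (\<lambda>\<omega>. Y \<omega> \<bullet> (X \<omega> *v Y \<omega>)) = expectation (\<lambda>\<omega>. Y \<omega> \<bullet> (expectation X *v Y \<omega>))"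
    unfolding form
    by (simp add: Bochner_Integration.integral_sum Bochner_Integration.integrable_sum prod YY Xij(2))
qed

text \<open>By monotone convergence the sum of all \<open>h k\<close> has finite expectation,
  hence is finite almost surely, and the terms of a convergent series tend to zero.\<close>

lemma (in prob_space) AE_tendsto_0_of_geometric_expectation:
  fixes h :: "nat \<Rightarrow> 'a \<Rightarrow> real"
  assumes int: "\<And>k. integrable M (h k)" and nonneg: "\<And>k \<omega>. 0 \<le> h k \<omega>"
    and le: "\<And>k. expectation (h k) \<le> c ^ k * C" and c: "0 \<le> c" "c < 1"
  shows "AE \<omega> in M. (\<lambda>k. h k \<omega>) \<longlonglongrightarrow> 0"
proof -
  have meas[measurable]: "h k \<in> borel_measurable M" for k
    using int by (rule borel_measurable_integrable)
  have "(\<integral>\<^sup>+\<omega>. (\<Sum>k. ennreal (h k \<omega>)) \<partial>M) = (\<Sum>k. \<integral>\<^sup>+\<omega>. ennreal (h k \<omega>) \<partial>M)"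
    by (rule nn_integral_suminf) simp
  also have "\<dots> = (\<Sum>k. ennreal (expectation (h k)))"
    by (simp add: nn_integral_eq_integral int nonneg)
  also have "\<dots> \<le> (\<Sum>k. ennreal (c ^ k * C))"
    by (intro suminf_le ennreal_leI le) simp_all
  also have "\<dots> < \<infinity>"
  proof -
    have "0 \<le> expectation (h 0)" by (rule Bochner_Integration.integral_nonneg[OF nonneg])
    then have C: "0 \<le> C" using le[of 0] by simp
    have "summable (\<lambda>k. c ^ k * C)" using c by (intro summable_mult2 summable_geometric) simp
    then have "(\<Sum>k. ennreal (c ^ k * C)) = ennreal (\<Sum>k. c ^ k * C)"
      using c C by (intro suminf_ennreal2) auto
    then show ?thesis by simp
  qed
  finally have fin: "(\<integral>\<^sup>+\<omega>. (\<Sum>k. ennreal (h k \<omega>)) \<partial>M) \<noteq> \<infinity>" by simp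
  have "AE \<omega> in M. (\<Sum>k. ennreal (h k \<omega>)) \<noteq> \<infinity>"
    by (rule nn_integral_noteq_infinite[OF _ fin]) simp
  then show ?thesis
  proof eventually_elim
    case (elim \<omega>)
    then have "summable (\<lambda>k. h k \<omega>)" using nonneg by (intro summable_suminf_not_top) auto
    then show ?case by (rule summable_LIMSEQ_zero)
  qed
qed

locale iid_projections = prob_space M for M :: "'w measure" +
  fixes S :: "nat \<Rightarrow> 'w \<Rightarrow> (real^'n) set"
  assumes iid: "iid_subspaces M S" and admissible: "admissible M (S 1)"
begin

abbreviation "X k \<omega> \<equiv> proj_matrix (S k \<omega>)"
abbreviation "P \<equiv> avg_proj M (S 1)"

lemma S_measurable: "1 \<le> k \<Longrightarrow> S k \<in> measurable M subspace_algebra"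
  using iid unfolding iid_subspaces_def indep_vars_def by auto

lemma S_subspace: "1 \<le> k \<Longrightarrow> \<omega> \<in> space M \<Longrightarrow> subspace (S k \<omega>)"
  using measurable_space[OF S_measurable] by (simp add: space_subspace_algebra)

lemma X_indep: "indep_vars (\<lambda>_. borel) X {1..}"
  using iid indep_vars_compose2[OF _ measurable_proj_matrix] unfolding iid_subspaces_def by blast

lemma X_integrable: "1 \<le> k \<Longrightarrow> integrable M (X k)"
  using measurable_compose[OF S_measurable measurable_proj_matrix]
  by (intro integrable_const_bound[OF AE_I2[OF norm_proj_matrix_le_card[OF S_subspace]]])

lemma expectation_X: "1 \<le> k \<Longrightarrow> expectation (X k) = P"
proof -
  assume k: "1 \<le> k"
  have "expectation (X k) = integral\<^sup>L (distr M subspace_algebra (S k)) proj_matrix"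
    by (rule integral_distr[symmetric, OF S_measurable[OF k] measurable_proj_matrix])
  also have "\<dots> = integral\<^sup>L (distr M subspace_algebra (S 1)) proj_matrix"
  proof -
    have "distr M subspace_algebra (S k) = distr M subspace_algebra (S 1)"
      using iid k unfolding iid_subspaces_def by blast
    then show ?thesis by (simp only:)
  qed
  also have "\<dots> = expectation (X 1)"
    by (rule integral_distr[OF S_measurable[OF order_refl] measurable_proj_matrix])
  finally show ?thesis by (simp add: avg_proj_def)
qed

lemma P_form:
  "integrable M (\<lambda>\<omega>. v \<bullet> (X 1 \<omega> *v w))" "expectation (\<lambda>\<omega>. v \<bullet> (X 1 \<omega> *v w)) = v \<bullet> (P *v w)"
  using integrable_bounded_linear[OF bounded_linear_matrix_form X_integrable[OF order_refl]]
    integral_bounded_linear[OF bounded_linear_matrix_form X_integrable[OF order_refl]]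
  by (auto simp: avg_proj_def)

lemma P_form_le: "v \<bullet> (P *v v) \<le> (norm v)\<^sup>2"
proof -
  have "expectation (\<lambda>\<omega>. v \<bullet> (X 1 \<omega> *v v)) \<le> expectation (\<lambda>\<omega>. (norm v)\<^sup>2)"
  proof (rule integral_mono[OF P_form(1)])
    fix \<omega> assume "\<omega> \<in> space M"
    then show "v \<bullet> (X 1 \<omega> *v v) \<le> (norm v)\<^sup>2"
      using S_subspace[of 1 \<omega>] by (simp add: inner_proj_matrix_self norm_proj_matrix_le power_mono)
  qed simp
  then show ?thesis unfolding P_form(2) by (simp add: prob_space)
qed

lemma P_transpose: "transpose P = P"
proof -
  have comm: "v \<bullet> (P *v w) = w \<bullet> (P *v v)" for v w
  proof -
    have "expectation (\<lambda>\<omega>. v \<bullet> (X 1 \<omega> *v w)) = expectation (\<lambda>\<omega>. w \<bullet> (X 1 \<omega> *v v))"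
    proof (rule Bochner_Integration.integral_cong[OF refl])
      fix \<omega> assume "\<omega> \<in> space M"
      then show "v \<bullet> (X 1 \<omega> *v w) = w \<bullet> (X 1 \<omega> *v v)"
        using inner_proj_matrix_commute[OF S_subspace, of 1 \<omega> v w] by (simp add: inner_commute)
    qed
    then show ?thesis by (simp only: P_form(2))
  qed
  have "v \<bullet> (transpose P *v w) = v \<bullet> (P *v w)" for v w
    using dot_lmul_matrix[of w P v] comm[of w v] by (simp add: inner_commute)
  then show ?thesis by (subst matrix_eq) (metis vector_eq_rdot inner_commute)
qed

text \<open>The form \<open>v \<bullet> P v\<close> is the expected squared length of the
  projection of \<open>v\<close>. It vanishes only if \<open>v\<close> is almost surely orthogonal
  to the selection, which admissibility excludes for \<open>v \<noteq> 0\<close>.\<close>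

lemma P_positive_definite: "positive_definite P"
proof -
  have "0 < v \<bullet> (P *v v)" if v: "v \<noteq> 0" for v
  proof -
    have nn: "0 \<le> v \<bullet> (X 1 \<omega> *v v)" if "\<omega> \<in> space M" for \<omega>
      using S_subspace[of 1 \<omega>] that by (simp add: inner_proj_matrix_self)
    then have "0 \<le> v \<bullet> (P *v v)"
      using P_form(2)[of v v] Bochner_Integration.integral_nonneg[of M "\<lambda>\<omega>. v \<bullet> (X 1 \<omega> *v v)"] by simp
    moreover have "v \<bullet> (P *v v) \<noteq> 0"
    proof
      assume "v \<bullet> (P *v v) = 0"
      then have "AE \<omega> in M. v \<bullet> (X 1 \<omega> *v v) = 0"
        using integral_nonneg_eq_0_iff_AE[OF P_form(1)[of v v]] nn P_form(2)[of v v] by auto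
      then have ae: "AE \<omega> in M. \<omega> \<in> {\<omega> \<in> space M. v \<in> (S 1 \<omega>)\<^sup>\<bottom>}"
        using AE_space
      proof eventually_elim
        case (elim \<omega>)
        then show ?case
          using S_subspace[of 1 \<omega>] by (simp add: inner_proj_matrix_self flip: proj_matrix_eq_0_iff)
      qed
      have "{\<omega> \<in> space M. v \<in> (S 1 \<omega>)\<^sup>\<bottom>} = (\<lambda>\<omega>. v \<bullet> (X 1 \<omega> *v v)) -` {0} \<inter> space M"
        using S_subspace[of 1]
        by (auto simp: inner_proj_matrix_self simp flip: proj_matrix_eq_0_iff)
      also have "\<dots> \<in> events"
        using borel_measurable_integrable[OF P_form(1)] by (rule measurable_sets) simp
      finally have "prob {\<omega> \<in> space M. v \<in> (S 1 \<omega>)\<^sup>\<bottom>} = 1"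
        using ae by (simp add: prob_eq_1)
      then show False using admissible v unfolding admissible_def by force
    qed
    ultimately show ?thesis by simp
  qed
  then show ?thesis using P_transpose by (simp add: positive_definite_def)
qed

lemma lambda_min_P: "0 < lambda_min P" "lambda_min P \<le> 1"
proof -
  have "lambda_min P \<in> eigenvalues P"
    unfolding lambda_min_def by (rule Min_in[OF rayleigh_bounds(3,4)[OF P_transpose]])
  then obtain v where v: "v \<noteq> 0" "P *v v = lambda_min P *\<^sub>R v" by (auto simp: eigenvalues_def)
  then have eq: "v \<bullet> (P *v v) = lambda_min P * (norm v)\<^sup>2" by (simp add: power2_norm_eq_inner)
  have pos: "0 < (norm v)\<^sup>2" using v by simp
  have "0 < lambda_min P * (norm v)\<^sup>2"
    using P_positive_definite v(1) eq by (metis positive_definite_def)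
  then show "0 < lambda_min P" using pos by (simp add: zero_less_mult_iff)
  have "lambda_min P * (norm v)\<^sup>2 \<le> 1 * (norm v)\<^sup>2" using P_form_le[of v] eq by simp
  then show "lambda_min P \<le> 1" using pos by (simp only: mult_le_cancel_right_pos)
qed

end

text \<open>The iteration moves towards \<open>T\<close> only inside the random subspace and
  leaves the orthogonal component alone.\<close>

locale random_projection_iteration = iid_projections M S
  for M :: "'w measure" and S :: "nat \<Rightarrow> 'w \<Rightarrow> (real^'n) set" +
  fixes T :: "real^'n \<Rightarrow> real^'n" and z0 :: "real^'n"
  assumes T_continuous: "continuous_on UNIV T"
begin

text \<open>The state is a function of the whole sequence of matrices \<open>A\<close>, of which step \<open>k\<close> reads only the entries \<open>1, \<dots>, k\<close>. This exhibits
\<open>z k\<close> as a measurable function of \<open>X 1, \<dots>, X k\<close>, from which independence of \<open>X (k + 1)\<close> follows.\<close>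

primrec iterate :: "nat \<Rightarrow> (nat \<Rightarrow> real^'n^'n) \<Rightarrow> real^'n" where
  "iterate 0 A = z0"
| "iterate (Suc k) A = A (Suc k) *v T (iterate k A) + (iterate k A - A (Suc k) *v iterate k A)"

abbreviation "z k \<omega> \<equiv> iterate k (\<lambda>i. X i \<omega>)"

text \<open>The iterates are bounded for each fixed \<open>k\<close>, because projections do not
  lengthen vectors and the continuous image of a ball is bounded. This settles all integrability
  questions below.\<close>

lemma z_bounded: "\<exists>K. \<forall>\<omega>\<in>space M. norm (z k \<omega>) \<le> K"
proof (induction k)
  case (Suc k)
  then obtain K where K: "\<And>\<omega>. \<omega> \<in> space M \<Longrightarrow> norm (z k \<omega>) \<le> K" by blast
  have "compact (T ` cball 0 K)"
    using continuous_on_subset[OF T_continuous] by (intro compact_continuous_image) auto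
  then obtain K' where K': "\<And>v. v \<in> T ` cball 0 K \<Longrightarrow> norm v \<le> K'"
    using compact_imp_bounded bounded_iff by metis
  have "norm (z (Suc k) \<omega>) \<le> K' + (K + K)" if \<omega>: "\<omega> \<in> space M" for \<omega>
  proof -
    have F: "subspace (S (Suc k) \<omega>)" using S_subspace \<omega> by simp
    have "norm (z (Suc k) \<omega>) \<le> norm (X (Suc k) \<omega> *v T (z k \<omega>))
        + (norm (z k \<omega>) + norm (X (Suc k) \<omega> *v z k \<omega>))"
      unfolding iterate.simps
      by (intro order_trans[OF norm_triangle_ineq] add_left_mono norm_triangle_ineq4)
    also have "\<dots> \<le> norm (T (z k \<omega>)) + (norm (z k \<omega>) + norm (z k \<omega>))"
      by (intro add_mono norm_proj_matrix_le F order_refl)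
    also have "\<dots> \<le> K' + (K + K)"
      using K[OF \<omega>] by (intro add_mono K') auto
    finally show ?thesis .
  qed
  then show ?case by blast
qed auto

lemma iterate_restrict: "{1..k} \<subseteq> I \<Longrightarrow> iterate k (restrict A I) = iterate k A"
proof (induction k)
  case (Suc k)
  then have "{1..k} \<subseteq> I" "Suc k \<in> I" by (auto simp: subset_iff)
  with Suc show ?case by simp
qed simp

lemma iterate_measurable:
  "{1..k} \<subseteq> I \<Longrightarrow> iterate k \<in> borel_measurable (Pi\<^sub>M I (\<lambda>_. borel))"
proof (induction k)
  case 0
  have "iterate 0 = (\<lambda>_. z0)" by (simp add: fun_eq_iff)
  then show ?case by simp
next
  case (Suc k)
  then have I: "{1..k} \<subseteq> I" "Suc k \<in> I" by (auto simp: subset_iff)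
  note IH = Suc.IH[OF I(1)]
  have A: "(\<lambda>A. A (Suc k)) \<in> borel_measurable (Pi\<^sub>M I (\<lambda>_. borel))"
    using I(2) by (rule measurable_component_singleton)
  have "(\<lambda>A. T (iterate k A)) \<in> borel_measurable (Pi\<^sub>M I (\<lambda>_. borel))"
    using measurable_compose[OF IH borel_measurable_continuous_onI[OF T_continuous]] .
  with A IH show ?case
    unfolding iterate.simps
    by (intro borel_measurable_add borel_measurable_diff borel_measurable_matrix_vector_mult)
qed

lemma z_indep_X:
  fixes h :: "real^'n \<Rightarrow> real" and h' :: "real^'n^'n \<Rightarrow> real"
  assumes h: "h \<in> borel_measurable borel" and h': "h' \<in> borel_measurable borel"
  shows "indep_var borel (\<lambda>\<omega>. h (z k \<omega>)) borel (\<lambda>\<omega>. h' (X (Suc k) \<omega>))"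
proof -
  let ?A = "{1..k}" and ?B = "{Suc k}"
  have "indep_var (Pi\<^sub>M ?A (\<lambda>_. borel)) (\<lambda>\<omega>. restrict (\<lambda>i. X i \<omega>) ?A)
      (Pi\<^sub>M ?B (\<lambda>_. borel)) (\<lambda>\<omega>. restrict (\<lambda>i. X i \<omega>) ?B)"
    by (rule indep_var_restrict[OF X_indep]) auto
  moreover have "(\<lambda>A. h (iterate k A)) \<in> borel_measurable (Pi\<^sub>M ?A (\<lambda>_. borel))"
    by (rule measurable_compose[OF iterate_measurable h]) simp
  moreover have "(\<lambda>A. h' (A (Suc k))) \<in> borel_measurable (Pi\<^sub>M ?B (\<lambda>_. borel))"
    by (rule measurable_compose[OF _ h']) (simp add: measurable_component_singleton)
  ultimately have "indep_var borel ((\<lambda>A. h (iterate k A)) \<circ> (\<lambda>\<omega>. restrict (\<lambda>i. X i \<omega>) ?A))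
      borel ((\<lambda>A. h' (A (Suc k))) \<circ> (\<lambda>\<omega>. restrict (\<lambda>i. X i \<omega>) ?B))"
    by (rule indep_var_compose)
  then show ?thesis by (simp add: comp_def iterate_restrict)
qed

lemma z_measurable: "z k \<in> borel_measurable M"
proof -
  have "(\<lambda>\<omega>. restrict (\<lambda>i. X i \<omega>) {1..k}) \<in> measurable M (Pi\<^sub>M {1..k} (\<lambda>_. borel))"
    using X_indep unfolding indep_vars_def by (intro measurable_restrict) auto
  from measurable_compose[OF this iterate_measurable[OF order_refl]] show ?thesis
    by (simp add: iterate_restrict)
qed

lemma continuous_image_z_bounded:
  fixes \<phi> :: "real^'n \<Rightarrow> 'b::real_normed_vector"
  assumes \<phi>: "continuous_on UNIV \<phi>"
  obtains K where "\<And>\<omega>. \<omega> \<in> space M \<Longrightarrow> norm (\<phi> (z k \<omega>)) \<le> K"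
proof -
  obtain K where K: "\<And>\<omega>. \<omega> \<in> space M \<Longrightarrow> norm (z k \<omega>) \<le> K" using z_bounded by blast
  have "compact (\<phi> ` cball 0 K)"
    using continuous_on_subset[OF \<phi>] by (intro compact_continuous_image) auto
  then obtain K' where K': "\<And>v. v \<in> \<phi> ` cball 0 K \<Longrightarrow> norm v \<le> K'"
    using compact_imp_bounded bounded_iff by metis
  show ?thesis
    by (rule that[of K']) (use K in \<open>auto intro!: K'\<close>)
qed

lemma integrable_continuous_image_z:
  fixes \<phi> :: "real^'n \<Rightarrow> real"
  assumes \<phi>: "continuous_on UNIV \<phi>"
  shows "integrable M (\<lambda>\<omega>. \<phi> (z k \<omega>))"
proof -
  obtain K where "\<And>\<omega>. \<omega> \<in> space M \<Longrightarrow> norm (\<phi> (z k \<omega>)) \<le> K"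
    using continuous_image_z_bounded[OF \<phi>] by blast
  then show ?thesis
    using measurable_compose[OF z_measurable borel_measurable_continuous_onI[OF \<phi>]]
    by (intro integrable_const_bound[where B = K] AE_I2)
qed

lemma expectation_quadratic_form_step:
  assumes \<phi>: "continuous_on UNIV \<phi>"
  shows "integrable M (\<lambda>\<omega>. \<phi> (z k \<omega>) \<bullet> (X (Suc k) \<omega> *v \<phi> (z k \<omega>)))"
    and "expectation (\<lambda>\<omega>. \<phi> (z k \<omega>) \<bullet> (X (Suc k) \<omega> *v \<phi> (z k \<omega>)))
      = expectation (\<lambda>\<omega>. \<phi> (z k \<omega>) \<bullet> (P *v \<phi> (z k \<omega>)))"
proof -
  obtain K where bd: "\<And>\<omega>. \<omega> \<in> space M \<Longrightarrow> norm (\<phi> (z k \<omega>)) \<le> K"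
    using continuous_image_z_bounded[OF \<phi>] by blast
  have meas: "(\<lambda>\<omega>. \<phi> (z k \<omega>)) \<in> borel_measurable M"
    by (rule measurable_compose[OF z_measurable borel_measurable_continuous_onI[OF \<phi>]])
  have ind: "indep_var borel (\<lambda>\<omega>. \<phi> (z k \<omega>) $ i * \<phi> (z k \<omega>) $ j)
      borel (\<lambda>\<omega>. X (Suc k) \<omega> $ i $ j)" for i j
    by (rule z_indep_X[where h = "\<lambda>v. \<phi> v $ i * \<phi> v $ j" and h' = "\<lambda>A. A $ i $ j"];
        intro borel_measurable_continuous_onI continuous_intros \<phi>)
  note E = expectation_quadratic_form_indep[OF meas ind bd X_integrable]
  show "integrable M (\<lambda>\<omega>. \<phi> (z k \<omega>) \<bullet> (X (Suc k) \<omega> *v \<phi> (z k \<omega>)))"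
    by (rule E(1)) simp_all
  have "expectation (\<lambda>\<omega>. \<phi> (z k \<omega>) \<bullet> (X (Suc k) \<omega> *v \<phi> (z k \<omega>)))
      = expectation (\<lambda>\<omega>. \<phi> (z k \<omega>) \<bullet> (expectation (X (Suc k)) *v \<phi> (z k \<omega>)))"
    by (rule E(2)) simp_all
  then show "expectation (\<lambda>\<omega>. \<phi> (z k \<omega>) \<bullet> (X (Suc k) \<omega> *v \<phi> (z k \<omega>)))
      = expectation (\<lambda>\<omega>. \<phi> (z k \<omega>) \<bullet> (P *v \<phi> (z k \<omega>)))"
    by (simp add: expectation_X)
qed

text \<open>After taking the expectation the projection of step \<open>k + 1\<close> becomes
  \<open>P\<close>, so the contraction is only required in the norm given by \<open>v \<bullet> P
  v\<close>. The decrease is measured in that form too, and the Rayleigh bound converts it into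
  squared distance.\<close>

lemma expected_distance_step:
  assumes contr: "\<And>v. (T v - zs) \<bullet> (P *v (T v - zs)) \<le> (1 - \<alpha>) * ((v - zs) \<bullet> (P *v (v - zs)))"
    and \<alpha>: "0 \<le> \<alpha>"
  shows "expectation (\<lambda>\<omega>. (norm (z (Suc k) \<omega> - zs))\<^sup>2)
    \<le> (1 - \<alpha> * lambda_min P) * expectation (\<lambda>\<omega>. (norm (z k \<omega> - zs))\<^sup>2)"
proof -
  define a b where "a v = T v - zs" and "b v = v - zs" for v
  have cont: "continuous_on UNIV a" "continuous_on UNIV b"
    unfolding a_def b_def by (intro continuous_intros T_continuous)+
  note A = expectation_quadratic_form_step[OF cont(1), of k]
  note B = expectation_quadratic_form_step[OF cont(2), of k]
  have contP: "continuous_on UNIV (\<lambda>v. h v \<bullet> (P *v h v))"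
    if h: "continuous_on UNIV h" for h :: "real^'n \<Rightarrow> real^'n"
    by (intro continuous_on_inner h bounded_linear.continuous_on[OF matrix_vector_mul_bounded_linear])
  have N: "integrable M (\<lambda>\<omega>. (norm (b (z k \<omega>)))\<^sup>2)"
    by (rule integrable_continuous_image_z) (intro continuous_intros cont)
  have PA: "integrable M (\<lambda>\<omega>. a (z k \<omega>) \<bullet> (P *v a (z k \<omega>)))"
    and PB: "integrable M (\<lambda>\<omega>. b (z k \<omega>) \<bullet> (P *v b (z k \<omega>)))"
    by (rule integrable_continuous_image_z[OF contP[OF cont(1)]])
      (rule integrable_continuous_image_z[OF contP[OF cont(2)]])
  have "expectation (\<lambda>\<omega>. (norm (z (Suc k) \<omega> - zs))\<^sup>2)
      = expectation (\<lambda>\<omega>. a (z k \<omega>) \<bullet> (X (Suc k) \<omega> *v a (z k \<omega>))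
          + (norm (b (z k \<omega>)))\<^sup>2 - b (z k \<omega>) \<bullet> (X (Suc k) \<omega> *v b (z k \<omega>)))"
  proof (rule Bochner_Integration.integral_cong[OF refl])
    fix \<omega> assume \<omega>: "\<omega> \<in> space M"
    have "z (Suc k) \<omega> - zs
        = X (Suc k) \<omega> *v a (z k \<omega>) + (b (z k \<omega>) - X (Suc k) \<omega> *v b (z k \<omega>))"
      by (simp add: a_def b_def matrix_vector_mult_diff_distrib algebra_simps)
    then show "(norm (z (Suc k) \<omega> - zs))\<^sup>2 = a (z k \<omega>) \<bullet> (X (Suc k) \<omega> *v a (z k \<omega>))
          + (norm (b (z k \<omega>)))\<^sup>2 - b (z k \<omega>) \<bullet> (X (Suc k) \<omega> *v b (z k \<omega>))"
      using norm_proj_matrix_combination[OF S_subspace, of "Suc k" \<omega>] \<omega> by simp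
  qed
  also have "\<dots> = expectation (\<lambda>\<omega>. a (z k \<omega>) \<bullet> (P *v a (z k \<omega>)))
      + expectation (\<lambda>\<omega>. (norm (b (z k \<omega>)))\<^sup>2) - expectation (\<lambda>\<omega>. b (z k \<omega>) \<bullet> (P *v b (z k \<omega>)))"
    using A B N by simp
  also have "\<dots> = expectation (\<lambda>\<omega>. a (z k \<omega>) \<bullet> (P *v a (z k \<omega>))
      + (norm (b (z k \<omega>)))\<^sup>2 - b (z k \<omega>) \<bullet> (P *v b (z k \<omega>)))"
    using PA PB N by simp
  also have "\<dots> \<le> expectation (\<lambda>\<omega>. (1 - \<alpha> * lambda_min P) * (norm (b (z k \<omega>)))\<^sup>2)"
  proof (rule integral_mono)
    fix \<omega>
    let ?b = "b (z k \<omega>)"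
    have "a (z k \<omega>) \<bullet> (P *v a (z k \<omega>)) \<le> (1 - \<alpha>) * (?b \<bullet> (P *v ?b))"
      using contr by (simp add: a_def b_def)
    moreover have "\<alpha> * (lambda_min P * (norm ?b)\<^sup>2) \<le> \<alpha> * (?b \<bullet> (P *v ?b))"
      by (intro mult_left_mono rayleigh_bounds(1)[OF P_transpose] \<alpha>)
    ultimately show "a (z k \<omega>) \<bullet> (P *v a (z k \<omega>)) + (norm ?b)\<^sup>2 - ?b \<bullet> (P *v ?b)
        \<le> (1 - \<alpha> * lambda_min P) * (norm ?b)\<^sup>2"
      by (simp add: algebra_simps)
  qed (use PA PB N in auto)
  finally show ?thesis by (simp add: b_def)
qed

lemma expected_distance_geometric:
  assumes contr: "\<And>v. (T v - zs) \<bullet> (P *v (T v - zs)) \<le> (1 - \<alpha>) * ((v - zs) \<bullet> (P *v (v - zs)))"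
    and \<alpha>: "0 \<le> \<alpha>" "\<alpha> \<le> 1"
  shows "expectation (\<lambda>\<omega>. (norm (z k \<omega> - zs))\<^sup>2) \<le> (1 - \<alpha> * lambda_min P) ^ k * (norm (z0 - zs))\<^sup>2"
proof (induction k)
  case 0
  have "expectation (\<lambda>\<omega>. (norm (z 0 \<omega> - zs))\<^sup>2) = expectation (\<lambda>\<omega>. (norm (z0 - zs))\<^sup>2)"
    by (rule Bochner_Integration.integral_cong) (simp_all add: iterate.simps)
  then show ?case by (simp add: prob_space)
next
  case (Suc k)
  have "\<alpha> * lambda_min P \<le> 1 * 1"
    using lambda_min_P \<alpha> by (intro mult_mono) auto
  then have "(1 - \<alpha> * lambda_min P) * expectation (\<lambda>\<omega>. (norm (z k \<omega> - zs))\<^sup>2)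
      \<le> (1 - \<alpha> * lambda_min P) * ((1 - \<alpha> * lambda_min P) ^ k * (norm (z0 - zs))\<^sup>2)"
    by (intro mult_left_mono Suc.IH) simp
  with expected_distance_step[OF contr \<alpha>(1), of k] show ?case
    by (simp add: mult.assoc)
qed

end

section \<open>Convergence of the algorithm\<close>

theorem theorem1:
  fixes M :: "'w measure"
    and f :: "real^'n \<Rightarrow> real" and g :: "real^'n \<Rightarrow> ereal"
    and C :: "'i \<Rightarrow> (real^'n) set"
    and S :: "nat \<Rightarrow> 'w \<Rightarrow> (real^'n) set"
    and x y z :: "nat \<Rightarrow> 'w \<Rightarrow> real^'n"
    and P Q :: "real^'n^'n"
    and xstar z0 :: "real^'n"
    and L \<mu> \<gamma> :: real
  assumes prob: "prob_space M"
    and f_smooth: "smooth_with L f"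
    and mu_pos: "\<mu> > 0"
    and f_strongly_convex: "strongly_convex \<mu> f"
    and g_convex: "convex_fun g"
    and g_proper: "proper_fun g"
    and g_lsc: "lsc_fun g"
    and xstar_min: "is_arg_min (\<lambda>v. ereal (f v) + g v) (\<lambda>_. True) xstar"
    and covering: "covering_family C"
    and selections: "\<forall>k\<ge>1. selection M C (S k) \<and> admissible M (S k)"
    and iid: "iid_subspaces M S"
    and P_def: "P = avg_proj M (S 1)"
    and Q_def: "Q = matrix_inv (matrix_sqrt P)"
    and gamma: "\<gamma> \<in> {0<..2 / (\<mu> + L)}"
    and run: "\<forall>\<omega>\<in>space M.
      rpsd_run \<gamma> f g Q (\<lambda>k. S k \<omega>) z0 (\<lambda>k. x k \<omega>) (\<lambda>k. y k \<omega>) (\<lambda>k. z k \<omega>)"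
  shows "(AE \<omega> in M. (\<lambda>k. x k \<omega>) \<longlonglongrightarrow> xstar) \<and>
    (\<forall>k. integrable M (\<lambda>\<omega>. (norm (x (k + 1) \<omega> - xstar))\<^sup>2) \<and>
      (\<integral>\<omega>. (norm (x (k + 1) \<omega> - xstar))\<^sup>2 \<partial>M)
        \<le> (1 - lambda_min P * (2 * \<gamma> * \<mu> * L / (\<mu> + L))) ^ k *
          (lambda_max P * (norm (z0 - Q *v (xstar - \<gamma> *\<^sub>R grad f xstar)))\<^sup>2))"
proof -
  interpret prob_space M by (rule prob)
  interpret f: smooth_strongly_convex f L \<mu>
    by unfold_locales (fact f_smooth f_strongly_convex mu_pos)+
  have \<gamma>: "0 < \<gamma>" "\<gamma> \<le> 2 / (\<mu> + L)" using gamma by auto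
  obtain s where prox_reg: "prox_regularization g xstar (- grad f xstar) s"
    using prox_regularization_at_composite_minimizer[OF g_convex g_proper g_lsc f.GDERIV_f xstar_min] .
  then interpret g: prox_regularization g xstar "- grad f xstar" s .
  interpret p: iid_projections M S
    by unfold_locales (use iid selections in auto)
  have pd: "positive_definite P" and trP: "transpose P = P"
    using p.P_positive_definite p.P_transpose by (simp_all only: P_def)
  define R where "R = matrix_sqrt P"
  have Q_inv: "matrix_inv Q = R" and RQ: "R *v (Q *v v) = v" for v
    using positive_definite_invertible[OF matrix_sqrt(1)[OF pd]]
    by (simp_all add: Q_def R_def matrix_inv_matrix_inv matrix_vector_mult_matrix_inv)
  have R_norm: "(norm (R *v v))\<^sup>2 = v \<bullet> (P *v v)" for v
    unfolding R_def by (rule norm_matrix_sqrt_squared[OF pd])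

  define F where "F u = u - \<gamma> *\<^sub>R grad f u" for u
  define T where "T v = Q *v F (prox \<gamma> g (R *v v))" for v
  define zs where "zs = Q *v F xstar"
  define \<alpha> where "\<alpha> = 2 * \<gamma> * \<mu> * L / (\<mu> + L)"
  have \<alpha>: "0 < \<alpha>" "\<alpha> \<le> 1" unfolding \<alpha>_def by (rule f.rate_bounds[OF \<gamma>])+
  have prox_zs: "prox \<gamma> g (R *v zs) = xstar"
    unfolding zs_def RQ F_def by (rule minimizer_is_forward_backward_fixed_point[OF \<gamma>(1) prox_reg])
  have prox_cont: "continuous_on UNIV (\<lambda>v. prox \<gamma> g (R *v v))"
  proof -
    have "1-lipschitz_on UNIV (prox \<gamma> g)"
      by (rule lipschitz_onI) (use g.prox_nonexpansive[OF \<gamma>(1)] in \<open>simp_all add: dist_norm\<close>)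
    from lipschitz_on_continuous_on[OF this] show ?thesis
      by (rule continuous_on_compose2) (auto intro: matrix_vector_mult_linear_continuous_on)
  qed
  have "continuous_on UNIV (grad f)"
    using f_smooth lipschitz_on_continuous_on unfolding smooth_with_def by blast
  then have "continuous_on UNIV F"
    unfolding F_def by (intro continuous_intros)
  then have T_cont: "continuous_on UNIV T"
    unfolding T_def
    by (intro bounded_linear.continuous_on[OF matrix_vector_mul_bounded_linear]
        continuous_on_compose2[OF _ prox_cont]) auto
  interpret it: random_projection_iteration M S T z0
    by unfold_locales (rule T_cont)

  have prox_dist: "(norm (prox \<gamma> g (R *v v) - xstar))\<^sup>2 \<le> (v - zs) \<bullet> (P *v (v - zs))" for v
  proof -
    have "norm (prox \<gamma> g (R *v v) - xstar) \<le> norm (R *v (v - zs))"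
      using g.prox_nonexpansive[OF \<gamma>(1), of "R *v v" "R *v zs"]
      by (simp add: prox_zs matrix_vector_mult_diff_distrib)
    from power_mono[OF this norm_ge_zero, of 2] show ?thesis by (simp only: R_norm)
  qed
  \<comment> \<open>Under \<open>R\<close> the preconditioned map \<open>T\<close> becomes the gradient step, and \<open>P\<close> becomes the identity.\<close>
  have contr: "(T v - zs) \<bullet> (P *v (T v - zs)) \<le> (1 - \<alpha>) * ((v - zs) \<bullet> (P *v (v - zs)))" for v
  proof -
    let ?u = "prox \<gamma> g (R *v v)"
    have "(T v - zs) \<bullet> (P *v (T v - zs)) = (norm (R *v (T v - zs)))\<^sup>2"
      by (simp only: R_norm)
    also have "R *v (T v - zs) = F ?u - F xstar"
      by (simp add: T_def zs_def RQ matrix_vector_mult_diff_distrib)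
    also have "(norm (F ?u - F xstar))\<^sup>2 \<le> (1 - \<alpha>) * (norm (?u - xstar))\<^sup>2"
      unfolding F_def \<alpha>_def by (rule f.forward_step_contraction[OF \<gamma>])
    also have "\<dots> \<le> (1 - \<alpha>) * ((v - zs) \<bullet> (P *v (v - zs)))"
      using \<alpha> by (intro mult_left_mono prox_dist) simp
    finally show ?thesis .
  qed
  \<comment> \<open>The initialization of \<open>x 1\<close> has the form of the general update because \<open>z 0 = z0\<close>.\<close>
  have run_z: "z k \<omega> = it.z k \<omega>" and run_x: "x (k + 1) \<omega> = prox \<gamma> g (R *v z k \<omega>)"
    if \<omega>: "\<omega> \<in> space M" for k \<omega>
  proof -
    have x1: "x 1 \<omega> = prox \<gamma> g (R *v z 0 \<omega>)" and z_0: "z 0 \<omega> = z0"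
      and rec: "\<And>k. 1 \<le> k \<Longrightarrow> y k \<omega> = Q *v F (x k \<omega>) \<and>
        z k \<omega> = proj_matrix (S k \<omega>) *v y k \<omega> + (mat 1 - proj_matrix (S k \<omega>)) *v z (k - 1) \<omega> \<and>
        x (k + 1) \<omega> = prox \<gamma> g (R *v z k \<omega>)"
      using run \<omega> by (auto simp: rpsd_run_def Q_inv F_def)
    show x: "x (k + 1) \<omega> = prox \<gamma> g (R *v z k \<omega>)" for k
      using x1 rec[of k] by (cases "k = 0") auto
    show "z k \<omega> = it.z k \<omega>"
    proof (induction k)
      case (Suc k)
      have "z (Suc k) \<omega> = proj_matrix (S (Suc k) \<omega>) *v y (Suc k) \<omega>
          + (mat 1 - proj_matrix (S (Suc k) \<omega>)) *v z k \<omega>"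
        using rec[of "Suc k"] by simp
      moreover have "y (Suc k) \<omega> = T (z k \<omega>)"
        using rec[of "Suc k"] x[of k] by (simp add: T_def)
      ultimately show ?case
        by (simp add: Suc matrix_vector_mult_diff_rdistrib)
    qed (simp add: z_0)
  qed

  define h where "h k \<omega> = (norm (prox \<gamma> g (R *v it.z k \<omega>) - xstar))\<^sup>2" for k \<omega>
  have x_h: "(norm (x (k + 1) \<omega> - xstar))\<^sup>2 = h k \<omega>" if "\<omega> \<in> space M" for k \<omega>
    using run_z[OF that] run_x[OF that] by (simp add: h_def)
  have h_int: "integrable M (h k)" for k
    unfolding h_def
    by (rule it.integrable_continuous_image_z) (intro continuous_intros prox_cont)
  define c where "c = 1 - lambda_min P * \<alpha>"
  define C where "C = lambda_max P * (norm (z0 - zs))\<^sup>2"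
  have rate: "expectation (h k) \<le> c ^ k * C" for k
  proof -
    have dist_int: "integrable M (\<lambda>\<omega>. (norm (it.z k \<omega> - zs))\<^sup>2)"
      by (rule it.integrable_continuous_image_z) (intro continuous_intros)
    have "expectation (h k) \<le> expectation (\<lambda>\<omega>. lambda_max P * (norm (it.z k \<omega> - zs))\<^sup>2)"
    proof (rule integral_mono[OF h_int])
      show "h k \<omega> \<le> lambda_max P * (norm (it.z k \<omega> - zs))\<^sup>2" for \<omega>
        unfolding h_def by (rule order_trans[OF prox_dist rayleigh_bounds(2)[OF trP]])
    qed (use dist_int in simp)
    also have "\<dots> = lambda_max P * expectation (\<lambda>\<omega>. (norm (it.z k \<omega> - zs))\<^sup>2)" by simp
    also have "\<dots> \<le> lambda_max P * (c ^ k * (norm (z0 - zs))\<^sup>2)"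
    proof (rule mult_left_mono)
      show "expectation (\<lambda>\<omega>. (norm (it.z k \<omega> - zs))\<^sup>2) \<le> c ^ k * (norm (z0 - zs))\<^sup>2"
        using it.expected_distance_geometric[of zs \<alpha> k] contr \<alpha>
        by (simp add: c_def P_def mult.commute)
      obtain v :: "real^'n" where v: "v \<noteq> 0" using zero_neq_one by metis
      then have "0 < lambda_max P * (norm v)\<^sup>2"
        using pd rayleigh_bounds(2)[OF trP, of v] unfolding positive_definite_def
        by (meson less_le_trans)
      then show "0 \<le> lambda_max P" by (simp add: zero_less_mult_iff)
    qed
    finally show ?thesis by (simp add: C_def mult_ac)
  qed
  have c: "0 \<le> c" "c < 1"
  proof -
    have lmin: "0 < lambda_min P" "lambda_min P \<le> 1"
      unfolding P_def by (rule p.lambda_min_P)+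
    have "0 < lambda_min P * \<alpha>"
      using lmin(1) \<alpha>(1) by (rule mult_pos_pos)
    moreover have "lambda_min P * \<alpha> \<le> 1 * 1"
      using lmin \<alpha> by (intro mult_mono) auto
    ultimately show "0 \<le> c" "c < 1" by (simp_all add: c_def)
  qed
  have "AE \<omega> in M. (\<lambda>k. h k \<omega>) \<longlonglongrightarrow> 0"
    by (rule AE_tendsto_0_of_geometric_expectation[OF h_int _ rate c]) (simp add: h_def)
  then have "AE \<omega> in M. (\<lambda>k. x k \<omega>) \<longlonglongrightarrow> xstar"
    using AE_space
  proof eventually_elim
    case (elim \<omega>)
    then have "(\<lambda>k. (norm (x (k + 1) \<omega> - xstar))\<^sup>2) \<longlonglongrightarrow> 0" by (simp only: x_h)
    then have "(\<lambda>k. sqrt ((norm (x (k + 1) \<omega> - xstar))\<^sup>2)) \<longlonglongrightarrow> sqrt 0"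
      by (rule tendsto_real_sqrt)
    then have "(\<lambda>k. x (k + 1) \<omega> - xstar) \<longlonglongrightarrow> 0"
      by (simp add: tendsto_norm_zero_iff)
    then have "(\<lambda>k. x (Suc k) \<omega>) \<longlonglongrightarrow> xstar"
      by (simp add: LIM_zero_iff)
    then show ?case by (rule LIMSEQ_imp_Suc)
  qed
  moreover have "integrable M (\<lambda>\<omega>. (norm (x (k + 1) \<omega> - xstar))\<^sup>2)"
    "expectation (\<lambda>\<omega>. (norm (x (k + 1) \<omega> - xstar))\<^sup>2) \<le> c ^ k * C" for k
  proof -
    show "integrable M (\<lambda>\<omega>. (norm (x (k + 1) \<omega> - xstar))\<^sup>2)"
      using h_int[of k] by (simp only: x_h cong: Bochner_Integration.integrable_cong)
    have "expectation (\<lambda>\<omega>. (norm (x (k + 1) \<omega> - xstar))\<^sup>2) = expectation (h k)"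
      by (rule Bochner_Integration.integral_cong) (simp_all only: x_h)
    then show "expectation (\<lambda>\<omega>. (norm (x (k + 1) \<omega> - xstar))\<^sup>2) \<le> c ^ k * C"
      using rate[of k] by (simp only:)
  qed
  ultimately show ?thesis
    unfolding c_def C_def \<alpha>_def zs_def F_def by blast
qed

end
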